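(* Let $K$ be a semihypergroup. Then $WAP_r(K)\cap UC(K)=WAP_l(K)\cap UC(K)$.
   Context: All topologies are Hausdorff. For a locally compact Hausdorff space $X$: $M(X)$ is the space of regular complex Borel measures on $X$; $M^+(X)$ is the set of finite non-negative regular Borel measures, with the cone topology (the weakest topology making $\mu\mapsto\int_X f\,d\mu$ continuous for every $f\in C_c^+(X)\cup\{1_X\}$, where $C_c^+(X)$ is the set of non-negative compactly supported continuous functions and $1_X$ is the constant function $1$); $\mathfrak{C}(X)$ is the set of compact subsets of $X$ with the Michael topology, generated by the sub-basis of sets $\{C\in\mathfrak{C}(X): C\cap U\neq\emptyset,\ C\subset V\}$ for $U,V$ open in $X$; $p_x$ is the point mass at $x$. A semihypergroup is a pair $(K,* )$ such that: (A1) $K$ is a locally compact Hausdorff space and $*$ is a binary operation making $M(K)$ an associative algebra; (A2) the bilinear map $*$ sends $M^+(K)\times M^+(K)$ into $M^+(K)$ and its restriction to $M^+(K)\times M^+(K)$ is (jointly) continuous; (A3) for all $x,y\in K$, $p_x*p_y$ is a probability measure with compact support; (A4) the map $(x,y)\mapsto \mathrm{supp}(p_x*p_y)$, $K\times K\to\mathfrak{C}(K)$, is continuous. $C(K)$ is the space of bounded continuous complex-valued functions on $K$ with the supremum norm. For measurable $f$ on $K$ and $x,y\in K$, $L_xf(y)=R_yf(x)=f(x*y):=\int_K f\,d(p_x*p_y)$. For $f\in C(K)$, $\mathcal{O}_r(f)=\{R_xf:x\in K\}$ and $\mathcal{O}_l(f)=\{L_xf:x\in K\}$. $WAP_r(K)$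 (resp. $WAP_l(K)$) is the set of $f\in C(K)$ such that $\mathcal{O}_r(f)$ (resp. $\mathcal{O}_l(f)$) is relatively compact in the weak topology of the Banach space $C(K)$. $UC(K)$ is the set of $f\in C(K)$ such that both maps $x\mapsto L_xf$ and $x\mapsto R_xf$ from $K$ to $C(K)$ (norm topology) are continuous. *)

theory Defs
  imports "HOL-Probability.Probability"
begin

section \<open>Regular complex Borel measures\<close>

text \<open>Complex Borel measures are represented by their set functions, extended by 0 to the sets
  that are not Borel, so that equality of measures is equality of functions and the vector space
  operations are pointwise.\<close>

definition complex_borel_measures :: "('a::topological_space set \<Rightarrow> complex) set" where
  "complex_borel_measures = {\<mu>.
     (\<forall>A. A \<notin> sets borel \<longrightarrow> \<mu> A = 0) \<and>
     (\<forall>A :: nat \<Rightarrow> 'a set. range A \<subseteq> sets borel \<longrightarrow> disjoint_family A \<longrightarrow>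
        (\<lambda>n. \<mu> (A n)) sums \<mu> (\<Union>n. A n))}"

definition total_variation :: "('a::topological_space set \<Rightarrow> complex) \<Rightarrow> 'a set \<Rightarrow> ennreal" where
  "total_variation \<mu> E =
     (SUP A \<in> {A :: nat \<Rightarrow> 'a set. range A \<subseteq> sets borel \<and> disjoint_family A \<and> (\<Union>n. A n) = E}.
        \<Sum>n. ennreal (cmod (\<mu> (A n))))"

definition regular_set_function :: "('a::topological_space set \<Rightarrow> ennreal) \<Rightarrow> bool" where
  "regular_set_function m \<longleftrightarrow>
     (\<forall>E \<in> sets borel.
        m E = (INF U \<in> {U. open U \<and> E \<subseteq> U}. m U) \<and>
        m E = (SUP C \<in> {C. compact C \<and> C \<subseteq> E}. m C))"

definition reg_measures :: "('a::topological_space set \<Rightarrow> complex) set" where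
  "reg_measures = {\<mu> \<in> complex_borel_measures. regular_set_function (total_variation \<mu>)}"

definition nonneg_reg_measures :: "('a::topological_space set \<Rightarrow> complex) set" where
  "nonneg_reg_measures = {\<mu> \<in> reg_measures. \<forall>A. \<mu> A \<in> \<real>\<^sub>\<ge>\<^sub>0}"

text \<open>Only meant for members of \<^const>\<open>nonneg_reg_measures\<close>, see \<open>emeasure_to_measure\<close> below.\<close>

definition to_measure :: "('a::topological_space set \<Rightarrow> complex) \<Rightarrow> 'a measure" where
  "to_measure \<mu> = measure_of UNIV (sets borel) (\<lambda>A. ennreal (Re (\<mu> A)))"

definition point_mass :: "'a::topological_space \<Rightarrow> 'a set \<Rightarrow> complex" where
  "point_mass x = (\<lambda>A. if A \<in> sets borel \<and> x \<in> A then 1 else 0)"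

definition measure_support :: "'a::topological_space measure \<Rightarrow> 'a set" where
  "measure_support M = {x. \<forall>U. open U \<longrightarrow> x \<in> U \<longrightarrow> emeasure M U > 0}"


section \<open>The cone topology and the Michael topology\<close>

definition Cc_nonneg :: "('a::topological_space \<Rightarrow> real) set" where
  "Cc_nonneg = {f. continuous_on UNIV f \<and> (\<forall>x. 0 \<le> f x) \<and> compact (closure {x. f x \<noteq> 0})}"

definition cone_topology :: "('a::topological_space set \<Rightarrow> complex) topology" where
  "cone_topology = topology_generated_by
     {{\<mu> \<in> nonneg_reg_measures. (\<integral>x. f x \<partial>to_measure \<mu>) \<in> U} | f U.
        f \<in> insert (\<lambda>_. 1) Cc_nonneg \<and> open (U :: real set)}"

text \<open>The empty set is compact but belongs to no sub-basic set; the set of all compact sets is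
  therefore listed explicitly among the generators (it is the empty intersection of sub-basic
  sets).\<close>

definition michael_topology :: "'a::topological_space set topology" where
  "michael_topology = topology_generated_by
     (insert {C. compact C} {{C. compact C \<and> C \<inter> U \<noteq> {} \<and> C \<subseteq> V} | U V. open U \<and> open V})"


section \<open>Semihypergroups\<close>

type_synonym 'a measure_op = "('a set \<Rightarrow> complex) \<Rightarrow> ('a set \<Rightarrow> complex) \<Rightarrow> ('a set \<Rightarrow> complex)"

locale semihypergroup =
  fixes conv :: "('a::t2_space) measure_op"
  assumes locally_compact: "locally_compact_space (euclidean :: 'a topology)"
    and conv_closed:
      "\<lbrakk>\<mu> \<in> reg_measures; \<nu> \<in> reg_measures\<rbrakk> \<Longrightarrow> conv \<mu> \<nu> \<in> reg_measures"
    and conv_add_left: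
      "\<lbrakk>\<mu> \<in> reg_measures; \<mu>' \<in> reg_measures; \<nu> \<in> reg_measures\<rbrakk>
       \<Longrightarrow> conv (\<lambda>A. \<mu> A + \<mu>' A) \<nu> = (\<lambda>A. conv \<mu> \<nu> A + conv \<mu>' \<nu> A)"
    and conv_add_right:
      "\<lbrakk>\<mu> \<in> reg_measures; \<nu> \<in> reg_measures; \<nu>' \<in> reg_measures\<rbrakk>
       \<Longrightarrow> conv \<mu> (\<lambda>A. \<nu> A + \<nu>' A) = (\<lambda>A. conv \<mu> \<nu> A + conv \<mu> \<nu>' A)"
    and conv_scale_left:
      "\<lbrakk>\<mu> \<in> reg_measures; \<nu> \<in> reg_measures\<rbrakk>
       \<Longrightarrow> conv (\<lambda>A. c * \<mu> A) \<nu> = (\<lambda>A. c * conv \<mu> \<nu> A)"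
    and conv_scale_right:
      "\<lbrakk>\<mu> \<in> reg_measures; \<nu> \<in> reg_measures\<rbrakk>
       \<Longrightarrow> conv \<mu> (\<lambda>A. c * \<nu> A) = (\<lambda>A. c * conv \<mu> \<nu> A)"
    and conv_assoc:
      "\<lbrakk>\<mu> \<in> reg_measures; \<nu> \<in> reg_measures; \<rho> \<in> reg_measures\<rbrakk>
       \<Longrightarrow> conv (conv \<mu> \<nu>) \<rho> = conv \<mu> (conv \<nu> \<rho>)"
    and conv_nonneg:
      "\<lbrakk>\<mu> \<in> nonneg_reg_measures; \<nu> \<in> nonneg_reg_measures\<rbrakk> \<Longrightarrow> conv \<mu> \<nu> \<in> nonneg_reg_measures"
    and conv_continuous:
      "continuous_map (prod_topology cone_topology cone_topology) cone_topology
         (\<lambda>(\<mu>, \<nu>). conv \<mu> \<nu>)"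
    and conv_point_masses_prob:
      "prob_space (to_measure (conv (point_mass x) (point_mass y)))"
    and conv_point_masses_compact:
      "compact (measure_support (to_measure (conv (point_mass x) (point_mass y))))"
    and support_continuous:
      "continuous_map euclidean michael_topology
         (\<lambda>(x, y). measure_support (to_measure (conv (point_mass x) (point_mass y))))"


section \<open>Translates and spaces of functions\<close>

text \<open>The value \<open>f(x * y)\<close>.\<close>

definition conv_eval ::
    "('a::t2_space) measure_op \<Rightarrow> ('a \<Rightarrow> complex) \<Rightarrow> 'a \<Rightarrow> 'a \<Rightarrow> complex" where
  "conv_eval conv f x y = (\<integral>z. f z \<partial>to_measure (conv (point_mass x) (point_mass y)))"

text \<open>For a semihypergroup the translates of a bounded continuous function are bounded and
  continuous, so that \<^const>\<open>Bcontfun\<close> is applied within its domain: see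
  \<open>apply_left_translate\<close> and \<open>apply_right_translate\<close> below.\<close>

definition left_translate ::
    "('a::t2_space) measure_op \<Rightarrow> 'a \<Rightarrow> ('a \<Rightarrow>\<^sub>C complex) \<Rightarrow> ('a \<Rightarrow>\<^sub>C complex)" where
  "left_translate conv x f = Bcontfun (\<lambda>y. conv_eval conv (apply_bcontfun f) x y)"

definition right_translate ::
    "('a::t2_space) measure_op \<Rightarrow> 'a \<Rightarrow> ('a \<Rightarrow>\<^sub>C complex) \<Rightarrow> ('a \<Rightarrow>\<^sub>C complex)" where
  "right_translate conv y f = Bcontfun (\<lambda>x. conv_eval conv (apply_bcontfun f) x y)"

definition left_orbit ::
    "('a::t2_space) measure_op \<Rightarrow> ('a \<Rightarrow>\<^sub>C complex) \<Rightarrow> ('a \<Rightarrow>\<^sub>C complex) set" where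
  "left_orbit conv f = range (\<lambda>x. left_translate conv x f)"

definition right_orbit ::
    "('a::t2_space) measure_op \<Rightarrow> ('a \<Rightarrow>\<^sub>C complex) \<Rightarrow> ('a \<Rightarrow>\<^sub>C complex) set" where
  "right_orbit conv f = range (\<lambda>x. right_translate conv x f)"

text \<open>The library makes \<open>'a \<Rightarrow>\<^sub>C complex\<close> a real normed space only, so complex homogeneity of the
  functionals is stated separately.\<close>

definition dual_bcontfun :: "(('a::topological_space \<Rightarrow>\<^sub>C complex) \<Rightarrow> complex) set" where
  "dual_bcontfun = {\<phi>. bounded_linear \<phi> \<and>
     (\<forall>c f g. (\<forall>x. apply_bcontfun g x = c * apply_bcontfun f x) \<longrightarrow> \<phi> g = c * \<phi> f)}"

definition weak_topology_bcontfun :: "('a::topological_space \<Rightarrow>\<^sub>C complex) topology" where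
  "weak_topology_bcontfun =
     topology_generated_by {\<phi> -` U | \<phi> U. \<phi> \<in> dual_bcontfun \<and> open U}"

definition relatively_weakly_compact :: "('a::topological_space \<Rightarrow>\<^sub>C complex) set \<Rightarrow> bool" where
  "relatively_weakly_compact S \<longleftrightarrow>
     compactin weak_topology_bcontfun (weak_topology_bcontfun closure_of S)"

definition WAP_r ::
    "('a::t2_space) measure_op \<Rightarrow> ('a \<Rightarrow>\<^sub>C complex) set" where
  "WAP_r conv = {f. relatively_weakly_compact (right_orbit conv f)}"

definition WAP_l ::
    "('a::t2_space) measure_op \<Rightarrow> ('a \<Rightarrow>\<^sub>C complex) set" where
  "WAP_l conv = {f. relatively_weakly_compact (left_orbit conv f)}"

definition UC ::
    "('a::t2_space) measure_op \<Rightarrow> ('a \<Rightarrow>\<^sub>C complex) set" where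
  "UC conv = {f. continuous_on UNIV (\<lambda>x. left_translate conv x f) \<and>
                 continuous_on UNIV (\<lambda>x. right_translate conv x f)}"


section \<open>Translates of bounded continuous functions are bounded and continuous\<close>

lemma space_to_measure [simp]: "space (to_measure \<mu>) = UNIV"
  by (simp add: to_measure_def space_measure_of_conv)

lemma sets_to_measure [simp, measurable_cong]: "sets (to_measure \<mu>) = sets borel"
  unfolding to_measure_def using sets.sigma_sets_eq[of borel]
  by (simp add: sets_measure_of_conv)

lemma emeasure_to_measure_aux:
  assumes \<mu>: "\<mu> \<in> complex_borel_measures" and nonneg: "\<And>A. \<mu> A \<in> \<real>\<^sub>\<ge>\<^sub>0"
    and A: "A \<in> sets borel"
  shows "emeasure (to_measure \<mu>) A = ennreal (Re (\<mu> A))"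
proof -
  have sums: "(\<lambda>n. \<mu> (A n)) sums \<mu> (\<Union>n. A n)"
    if "range A \<subseteq> sets borel" "disjoint_family A" for A :: "nat \<Rightarrow> _"
    using that \<mu> by (auto simp: complex_borel_measures_def)
  have "(\<lambda>n::nat. \<mu> {}) sums \<mu> {}"
    using sums[of "\<lambda>_. {}"] by (simp add: disjoint_family_on_def)
  then have "\<mu> {} = 0"
    by (simp add: sums_iff summable_const_iff)
  moreover have "0 \<le> Re (\<mu> A)" for A
    using nonneg[of A] by (auto simp: nonneg_Reals_def)
  moreover have "countably_additive (sets borel) (\<lambda>A. ennreal (Re (\<mu> A)))"
    unfolding countably_additive_def
  proof (intro allI impI)
    fix A :: "nat \<Rightarrow> 'a set"
    assume A: "range A \<subseteq> sets borel" "disjoint_family A"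
    have "(\<lambda>n. Re (\<mu> (A n))) sums Re (\<mu> (\<Union>n. A n))"
      using sums[OF A] by (rule sums_Re)
    then show "(\<Sum>n. ennreal (Re (\<mu> (A n)))) = ennreal (Re (\<mu> (\<Union>n. A n)))"
      using calculation(2) by (simp add: suminf_ennreal2 sums_iff)
  qed
  ultimately show ?thesis
    unfolding to_measure_def using A sets.sigma_algebra_axioms[of borel]
    by (intro emeasure_measure_of_sigma) (auto simp: positive_def)
qed

lemma emeasure_to_measure:
  assumes "\<mu> \<in> nonneg_reg_measures" "A \<in> sets borel"
  shows "emeasure (to_measure \<mu>) A = ennreal (Re (\<mu> A))"
  using assms emeasure_to_measure_aux by (auto simp: nonneg_reg_measures_def reg_measures_def)

lemma total_variation_nonneg:
  assumes \<mu>: "\<mu> \<in> complex_borel_measures" and nonneg: "\<And>A. \<mu> A \<in> \<real>\<^sub>\<ge>\<^sub>0"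
    and E: "E \<in> sets borel"
  shows "total_variation \<mu> E = emeasure (to_measure \<mu>) E"
proof -
  let ?P = "{A :: nat \<Rightarrow> 'a set. range A \<subseteq> sets borel \<and> disjoint_family A \<and> (\<Union>n. A n) = E}"
  have cmod: "cmod (\<mu> A) = Re (\<mu> A)" for A
    using nonneg[of A] by (auto simp: nonneg_Reals_def)
  have "(\<Sum>n. ennreal (cmod (\<mu> (A n)))) = emeasure (to_measure \<mu>) E" if "A \<in> ?P" for A
  proof -
    have "(\<Sum>n. ennreal (cmod (\<mu> (A n)))) = (\<Sum>n. emeasure (to_measure \<mu>) (A n))"
      using that by (intro suminf_cong) (auto simp: cmod emeasure_to_measure_aux[OF \<mu> nonneg])
    also have "\<dots> = emeasure (to_measure \<mu>) (\<Union>n. A n)"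
      using that by (intro suminf_emeasure) auto
    finally show ?thesis using that by auto
  qed
  moreover have "(\<lambda>n. if n = 0 then E else {}) \<in> ?P"
    using E by (auto simp: disjoint_family_on_def)
  then have "?P \<noteq> {}" by blast
  ultimately show ?thesis
    unfolding total_variation_def by (metis (mono_tags, lifting) SUP_eq_const)
qed

lemma point_mass_nonneg_borel:
  fixes x :: "'a::t2_space"
  shows "point_mass x \<in> complex_borel_measures" "point_mass x A \<in> \<real>\<^sub>\<ge>\<^sub>0"
proof -
  have "(\<lambda>n. point_mass x (A n)) sums point_mass x (\<Union>n. A n)"
    if A: "range A \<subseteq> sets borel" "disjoint_family A" for A :: "nat \<Rightarrow> 'a set"
  proof (cases "x \<in> (\<Union>n. A n)")
    case True
    then obtain n where n: "x \<in> A n" by blast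
    then have "x \<in> A m \<longleftrightarrow> m = n" for m
      using A(2) by (auto simp: disjoint_family_on_def)
    moreover have "A m \<in> sets borel" for m using A(1) by blast
    ultimately have "point_mass x (A m) = (if m = n then 1 else 0)" for m
      by (simp add: point_mass_def)
    moreover have "point_mass x (\<Union>n. A n) = 1"
      using True A(1) by (auto simp: point_mass_def)
    ultimately show ?thesis
      using sums_single[of n "\<lambda>_. 1 :: complex"] by simp
  qed (simp add: point_mass_def)
  then show "point_mass x \<in> complex_borel_measures"
    by (auto simp: complex_borel_measures_def point_mass_def)
qed (auto simp: point_mass_def)

lemma to_measure_point_mass:
  "to_measure (point_mass (x::'a::t2_space)) = return borel x"
proof (rule measure_eqI)
  fix A assume "A \<in> sets (to_measure (point_mass x))"
  then have A: "A \<in> sets borel" by simp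
  have "emeasure (to_measure (point_mass x)) A = ennreal (Re (point_mass x A))"
    using point_mass_nonneg_borel(1) point_mass_nonneg_borel(2) A by (rule emeasure_to_measure_aux)
  also have "\<dots> = emeasure (return borel x) A"
    using A by (simp add: point_mass_def)
  finally show "emeasure (to_measure (point_mass x)) A = emeasure (return borel x) A" .
qed simp

lemma point_mass_nonneg_reg: "point_mass (x::'a::t2_space) \<in> nonneg_reg_measures"
proof -
  let ?m = "total_variation (point_mass x)"
  have m: "?m E = indicator E x" if "E \<in> sets borel" for E
    using that by (simp add: total_variation_nonneg point_mass_nonneg_borel to_measure_point_mass)
  have "?m E = (INF U \<in> {U. open U \<and> E \<subseteq> U}. ?m U)" if E: "E \<in> sets borel" for E
  proof (rule antisym)
    show "?m E \<le> (INF U \<in> {U. open U \<and> E \<subseteq> U}. ?m U)"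
      using E by (intro INF_greatest) (auto simp: m indicator_def)
    have "\<exists>U. open U \<and> E \<subseteq> U \<and> ?m U \<le> ?m E"
    proof (cases "x \<in> E")
      case True
      then show ?thesis using E by (intro exI[of _ UNIV]) (auto simp: m)
    next
      case False
      then show ?thesis using E by (intro exI[of _ "- {x}"]) (auto simp: m)
    qed
    then show "(INF U \<in> {U. open U \<and> E \<subseteq> U}. ?m U) \<le> ?m E"
      by (auto intro: INF_lower2)
  qed
  moreover have "?m E = (SUP C \<in> {C. compact C \<and> C \<subseteq> E}. ?m C)" if E: "E \<in> sets borel" for E
  proof (rule antisym)
    show "(SUP C \<in> {C. compact C \<and> C \<subseteq> E}. ?m C) \<le> ?m E"
      using E by (intro SUP_least) (auto simp: m borel_compact indicator_def)
    have "\<exists>C. compact C \<and> C \<subseteq> E \<and> ?m E \<le> ?m C"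
      using E by (intro exI[of _ "if x \<in> E then {x} else {}"]) (auto simp: m)
    then show "?m E \<le> (SUP C \<in> {C. compact C \<and> C \<subseteq> E}. ?m C)"
      by (auto intro: SUP_upper2)
  qed
  ultimately have "regular_set_function ?m"
    unfolding regular_set_function_def by blast
  then show ?thesis
    by (simp add: nonneg_reg_measures_def reg_measures_def point_mass_nonneg_borel)
qed

lemma topspace_cone_topology [simp]: "topspace cone_topology = nonneg_reg_measures"
  unfolding cone_topology_def topology_generated_by_topspace by blast

lemma continuous_map_point_mass: "continuous_map euclidean cone_topology (point_mass :: 'a::t2_space \<Rightarrow> _)"
  unfolding cone_topology_def
proof (rule continuous_on_generated_topo)
  show "point_mass ` topspace euclidean \<subseteq> \<Union> {{\<mu> \<in> nonneg_reg_measures. (\<integral>x. f x \<partial>to_measure \<mu>) \<in> U} | f U.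
        f \<in> insert (\<lambda>_. 1) (Cc_nonneg :: ('a \<Rightarrow> real) set) \<and> open (U :: real set)}"
    using point_mass_nonneg_reg by blast
next
  fix S :: "('a set \<Rightarrow> complex) set"
  assume "S \<in> {{\<mu> \<in> nonneg_reg_measures. (\<integral>x. f x \<partial>to_measure \<mu>) \<in> U} | f U.
        f \<in> insert (\<lambda>_. 1) (Cc_nonneg :: ('a \<Rightarrow> real) set) \<and> open (U :: real set)}"
  then obtain f :: "'a \<Rightarrow> real" and U where f: "f \<in> insert (\<lambda>_. 1) Cc_nonneg" and U: "open U"
    and S: "S = {\<mu> \<in> nonneg_reg_measures. (\<integral>x. f x \<partial>to_measure \<mu>) \<in> U}" by blast
  from f have cont: "continuous_on UNIV f" by (auto simp: Cc_nonneg_def)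
  then have "(\<integral>y. f y \<partial>to_measure (point_mass x)) = f x" for x
    unfolding to_measure_point_mass
    by (intro integral_return) (auto intro: borel_measurable_continuous_onI)
  then have "point_mass -` S = f -` U"
    using point_mass_nonneg_reg by (auto simp: S)
  then show "openin euclidean (point_mass -` S \<inter> topspace euclidean)"
    using cont U by (simp add: open_vimage)
qed

lemma compact_cutoff:
  assumes "locally_compact_space (euclidean :: 'a::t2_space topology)" "compact (C :: 'a set)"
  obtains g where "g \<in> Cc_nonneg" "\<And>x. g x \<le> 1" "\<And>x. x \<in> C \<Longrightarrow> g x = 1"
proof -
  have haus: "Hausdorff_space (euclidean :: 'a topology)"
    unfolding Hausdorff_space_def disjnt_def
  proof (intro allI impI)
    fix x y :: 'a assume "x \<in> topspace euclidean \<and> y \<in> topspace euclidean \<and> x \<noteq> y"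
    then obtain U V where "open U" "open V" "x \<in> U" "y \<in> V" "U \<inter> V = {}"
      using hausdorff[of x y] by blast
    then show "\<exists>U V. openin euclidean U \<and> openin euclidean V \<and> x \<in> U \<and> y \<in> V \<and> U \<inter> V = {}"
      unfolding open_openin[symmetric] by blast
  qed
  then have creg: "completely_regular_space (euclidean :: 'a topology)"
    using locally_compact_Hausdorff_imp_regular_space[OF assms(1)]
      completely_regular_eq_regular_space[OF assms(1)] by simp
  obtain V L where V: "open V" "compact L" "C \<subseteq> V" "V \<subseteq> L" "closed L"
  proof -
    have "compactin euclidean C" using assms(2) by simp
    then obtain V L where "openin euclidean V" "compactin euclidean L" "closedin euclidean L"
      "C \<subseteq> V" "V \<subseteq> L"
      using assms(1)[unfolded locally_compact_space_compact_closed_compact[OF disjI1[OF haus]]]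
      by blast
    then show ?thesis using that by simp
  qed
  obtain g where g: "continuous_map euclidean (top_of_set {0..1::real}) g"
    "g ` (-V) \<subseteq> {0}" "g ` C \<subseteq> {1}"
  proof (rule Urysohn_completely_regular_compact_closed[OF _ creg, of 0 1 C "-V"])
  qed (use assms V haus in \<open>auto simp: disjnt_def intro: compact_imp_closed\<close>)
  show thesis
  proof
    have "closure {x. g x \<noteq> 0} \<subseteq> L"
    proof (rule closure_minimal)
      show "{x. g x \<noteq> 0} \<subseteq> L"
        using g(2) V(4) by blast
    qed (rule V(5))
    then have "compact (closure {x. g x \<noteq> 0})"
      using V(2) by (metis closed_closure compact_Int_closed inf.absorb_iff2)
    then show "g \<in> Cc_nonneg"
      using g(1) by (auto simp: Cc_nonneg_def continuous_map_in_subtopology Pi_iff)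
  qed (use g in \<open>auto simp: continuous_map_in_subtopology Pi_iff\<close>)
qed

lemma continuous_on_integral_cone_aux:
  fixes g :: "'b::topological_space \<Rightarrow> 'a::t2_space set \<Rightarrow> complex"
  assumes g: "continuous_map euclidean cone_topology g" and f: "f \<in> Cc_nonneg"
  shows "continuous_on UNIV (\<lambda>y. \<integral>x. f x \<partial>to_measure (g y))"
proof -
  have mem: "g y \<in> nonneg_reg_measures" for y
    using continuous_map_image_subset_topspace[OF g] by auto
  have "open ((\<lambda>y. \<integral>x. f x \<partial>to_measure (g y)) -` U)" if "open U" for U
  proof -
    have "openin euclidean (g -` {\<mu> \<in> nonneg_reg_measures. (\<integral>x. f x \<partial>to_measure \<mu>) \<in> U} \<inter> topspace euclidean)"
      using g f that unfolding cone_topology_def continuous_on_generated_topo_iff by blast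
    moreover have "g -` {\<mu> \<in> nonneg_reg_measures. (\<integral>x. f x \<partial>to_measure \<mu>) \<in> U} \<inter> topspace euclidean
      = (\<lambda>y. \<integral>x. f x \<partial>to_measure (g y)) -` U"
      using mem by auto
    ultimately show ?thesis by simp
  qed
  then show ?thesis by (simp add: continuous_on_open_vimage)
qed

lemma lsc_integral_cone:
  fixes g :: "'b::topological_space \<Rightarrow> 'a::t2_space set \<Rightarrow> complex" and h :: "'a \<Rightarrow> real"
  assumes lc: "locally_compact_space (euclidean :: 'a topology)"
    and g: "continuous_map euclidean cone_topology g" and prob: "\<And>y. prob_space (to_measure (g y))"
    and h: "continuous_on UNIV h" and B: "\<And>x. \<bar>h x\<bar> \<le> B" and e: "e > 0"
  shows "\<exists>V. open V \<and> y0 \<in> V \<and> (\<forall>y\<in>V. (\<integral>x. h x \<partial>to_measure (g y)) > (\<integral>x. h x \<partial>to_measure (g y0)) - e)"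
proof -
  have B0: "B \<ge> 0" using B[of undefined] by linarith
  define d where "d = e / (2 * B + 1)"
  have d: "d > 0" "2 * B * d < e"
    using e B0 by (simp_all add: d_def pos_divide_less_eq algebra_simps)
  let ?M = "\<lambda>y. to_measure (g y)"
  have mem: "g y \<in> nonneg_reg_measures" for y
    using continuous_map_image_subset_topspace[OF g] by auto
  have "total_variation (g y0) UNIV = 1"
    using prob_space.emeasure_space_1[OF prob[of y0]] mem[of y0]
      total_variation_nonneg[of "g y0" UNIV]
    by (simp add: nonneg_reg_measures_def reg_measures_def)
  moreover have "total_variation (g y0) UNIV = (SUP C \<in> {C. compact C}. total_variation (g y0) C)"
  proof -
    have "regular_set_function (total_variation (g y0))"
      using mem[of y0] by (simp add: nonneg_reg_measures_def reg_measures_def)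
    then have "total_variation (g y0) UNIV =
        (SUP C \<in> {C. compact C \<and> C \<subseteq> UNIV}. total_variation (g y0) C)"
      unfolding regular_set_function_def by (metis sets.top space_borel)
    then show ?thesis by (simp only: subset_UNIV simp_thms)
  qed
  moreover have "ennreal (1 - d) < 1"
    using d by (simp add: ennreal_less_one_iff)
  ultimately have "ennreal (1 - d) < (SUP C \<in> {C. compact C}. total_variation (g y0) C)"
    by metis
  then obtain C where C: "compact C" "ennreal (1 - d) < total_variation (g y0) C"
    by (auto simp: less_SUP_iff)
  then have C': "measure (?M y0) C > 1 - d"
  proof -
    have "total_variation (g y0) C = emeasure (?M y0) C"
      using mem[of y0] C(1)
      by (intro total_variation_nonneg) (auto simp: nonneg_reg_measures_def reg_measures_def borel_compact)
    also have "\<dots> = ennreal (measure (?M y0) C)"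
      using prob[of y0] by (simp add: finite_measure.emeasure_eq_measure prob_space_def)
    finally show ?thesis using C(2) by (metis ennreal_leI linorder_not_less)
  qed
  obtain c where c: "c \<in> Cc_nonneg" "\<And>x. c x \<le> 1" "\<And>x. x \<in> C \<Longrightarrow> c x = 1"
    using compact_cutoff[OF lc C(1)] by blast
  have c0: "0 \<le> c x" for x using c(1) by (simp add: Cc_nonneg_def)
  have contc: "continuous_on UNIV c" using c(1) by (simp add: Cc_nonneg_def)
  define k where "k x = (h x + B) * c x" for x
  have hB: "0 \<le> h x + B" "h x + B \<le> 2 * B" for x using B[of x] by auto
  have k: "k \<in> Cc_nonneg"
  proof -
    have "{x. k x \<noteq> 0} \<subseteq> {x. c x \<noteq> 0}" by (auto simp: k_def)
    then have "compact (closure {x. k x \<noteq> 0})"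
      using c(1) by (metis (mono_tags, lifting) Cc_nonneg_def closed_closure closure_mono
          compact_Int_closed inf.absorb_iff2 mem_Collect_eq)
    then show ?thesis using hB c0 contc h
      by (auto simp: Cc_nonneg_def k_def intro!: continuous_intros)
  qed
  have kB: "0 \<le> k x" "k x \<le> h x + B" "k x \<le> 2 * B" for x
  proof -
    show "0 \<le> k x" using hB c0 by (simp add: k_def)
    show "k x \<le> h x + B" using hB(1)[of x] c0 c(2)[of x] by (simp add: k_def mult_left_le)
    then show "k x \<le> 2 * B" using hB(2)[of x] by linarith
  qed
  have int: "integrable (?M y) f" if "continuous_on UNIV f" "\<And>x. \<bar>f x\<bar> \<le> b" for y b and f :: "'a \<Rightarrow> real"
  proof -
    interpret prob_space "?M y" by (rule prob)
    show ?thesis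
      by (rule integrable_const_bound[of _ b])
         (use that in \<open>auto simp: measurable_cong_sets[OF sets_to_measure refl] intro: borel_measurable_continuous_onI\<close>)
  qed
  have inth: "integrable (?M y) h" for y using int[OF h B] .
  have contk: "continuous_on UNIV k" using k by (simp add: Cc_nonneg_def)
  have intk: "integrable (?M y) k" for y
    using int[OF contk, of "2*B"] kB by (metis abs_of_nonneg)
  have lower: "(\<integral>x. k x \<partial>?M y) \<le> (\<integral>x. h x \<partial>?M y) + B" for y
  proof -
    interpret prob_space "?M y" by (rule prob)
    have "(\<integral>x. k x \<partial>?M y) \<le> (\<integral>x. h x + B \<partial>?M y)"
      using inth intk kB by (intro integral_mono) auto
    then show ?thesis using inth prob_space by simp
  qed
  have upper: "(\<integral>x. h x \<partial>?M y0) + B - e < (\<integral>x. k x \<partial>?M y0)"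
  proof -
    interpret prob_space "?M y0" by (rule prob)
    have Cb: "C \<in> sets borel" using C(1) by (rule borel_compact)
    have "(\<integral>x. h x + B - k x \<partial>?M y0) \<le> (\<integral>x. 2 * B * indicator (- C) x \<partial>?M y0)"
    proof (rule integral_mono)
      show "h x + B - k x \<le> 2 * B * indicator (- C) x" for x
        using hB[of x] kB[of x] c(3)[of x] by (auto simp: k_def indicator_def)
      show "integrable (?M y0) (\<lambda>x. 2 * B * indicator (- C) x)"
        using Cb by (intro integrable_mult_right integrable_real_indicator) (auto simp: emeasure_eq_measure)
    qed (use inth intk in auto)
    also have "\<dots> = 2 * B * (1 - measure (?M y0) C)"
      using Cb prob_compl[of C] by (simp add: Compl_eq_Diff_UNIV)
    also have "\<dots> \<le> 2 * B * d" using C' B0 by (intro mult_left_mono) auto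
    also have "\<dots> < e" by (rule d)
    finally show ?thesis using inth intk prob_space by simp
  qed
  let ?V = "(\<lambda>y. \<integral>x. k x \<partial>?M y) -` {(\<integral>x. h x \<partial>?M y0) + B - e <..}"
  have "open ?V"
    using continuous_on_integral_cone_aux[OF g k] by (simp add: open_vimage)
  moreover have "y0 \<in> ?V" using upper by simp
  moreover have "(\<integral>x. h x \<partial>?M y) > (\<integral>x. h x \<partial>?M y0) - e" if "y \<in> ?V" for y
    using that lower[of y] by simp
  ultimately show ?thesis by blast
qed

lemma continuous_integral_cone_real:
  fixes g :: "'b::topological_space \<Rightarrow> 'a::t2_space set \<Rightarrow> complex" and h :: "'a \<Rightarrow> real"
  assumes lc: "locally_compact_space (euclidean :: 'a topology)"
    and g: "continuous_map euclidean cone_topology g" and prob: "\<And>y. prob_space (to_measure (g y))"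
    and h: "continuous_on UNIV h" and B: "\<And>x. \<bar>h x\<bar> \<le> B"
  shows "continuous_on UNIV (\<lambda>y. \<integral>x. h x \<partial>to_measure (g y))"
proof -
  let ?F = "\<lambda>y. \<integral>x. h x \<partial>to_measure (g y)"
  have "(?F \<longlongrightarrow> ?F y0) (at y0)" for y0
  proof (rule tendstoI)
    fix e :: real assume e: "e > 0"
    obtain V where V: "open V" "y0 \<in> V" "\<And>y. y \<in> V \<Longrightarrow> ?F y > ?F y0 - e"
      using lsc_integral_cone[where ?y0.0 = y0, OF lc g prob h B e] by metis
    have h': "continuous_on UNIV (\<lambda>x. - h x)" using h by (rule continuous_on_minus)
    have B': "\<bar>- h x\<bar> \<le> B" for x using B by simp
    have neg: "(\<integral>x. - h x \<partial>to_measure (g y)) = - ?F y" for y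
      by (rule Bochner_Integration.integral_minus)
    obtain W where W: "open W" "y0 \<in> W" "\<And>y. y \<in> W \<Longrightarrow> - ?F y > - ?F y0 - e"
      using lsc_integral_cone[where ?y0.0 = y0, OF lc g prob h' B' e] unfolding neg by metis
    have "\<forall>\<^sub>F y in at y0. y \<in> V \<inter> W"
      unfolding eventually_at_topological using V(1,2) W(1,2) by (intro exI[of _ "V \<inter> W"]) auto
    then show "\<forall>\<^sub>F y in at y0. dist (?F y) (?F y0) < e"
    proof (rule eventually_mono)
      fix y assume "y \<in> V \<inter> W"
      then show "dist (?F y) (?F y0) < e"
        using V(3)[of y] W(3)[of y] by (simp add: dist_real_def abs_less_iff)
    qed
  qed
  then show ?thesis by (simp add: continuous_on_def)
qed

lemma bcontfun_integral_cone:
  fixes g :: "'b::topological_space \<Rightarrow> 'a::t2_space set \<Rightarrow> complex" and f :: "'a \<Rightarrow>\<^sub>C complex"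
  assumes lc: "locally_compact_space (euclidean :: 'a topology)"
    and g: "continuous_map euclidean cone_topology g" and prob: "\<And>y. prob_space (to_measure (g y))"
  shows "(\<lambda>y. \<integral>x. apply_bcontfun f x \<partial>to_measure (g y)) \<in> bcontfun"
proof -
  let ?f = "apply_bcontfun f"
  let ?M = "\<lambda>y. to_measure (g y)"
  obtain B where B: "cmod (?f x) \<le> B" for x
    using bounded_apply_bcontfun[of f] by (auto simp: bounded_iff)
  have contf: "continuous_on UNIV ?f" by simp
  have int: "integrable (?M y) ?f" for y
  proof -
    interpret prob_space "?M y" by (rule prob)
    show ?thesis
      by (rule integrable_const_bound[of _ B])
         (use B contf in \<open>auto simp: measurable_cong_sets[OF sets_to_measure refl] intro: borel_measurable_continuous_onI\<close>)
  qed
  have eq: "(\<integral>x. ?f x \<partial>?M y) = Complex (\<integral>x. Re (?f x) \<partial>?M y) (\<integral>x. Im (?f x) \<partial>?M y)" for y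
    using int[of y] by (simp add: complex_eq_iff)
  have "continuous_on UNIV (\<lambda>y. \<integral>x. Re (?f x) \<partial>?M y)" 
    by (rule continuous_integral_cone_real[OF lc g prob, of _ B])
       (use contf B in \<open>auto intro: continuous_intros order_trans[OF abs_Re_le_cmod]\<close>)
  moreover have "continuous_on UNIV (\<lambda>y. \<integral>x. Im (?f x) \<partial>?M y)" 
    by (rule continuous_integral_cone_real[OF lc g prob, of _ B])
       (use contf B in \<open>auto intro: continuous_intros order_trans[OF abs_Im_le_cmod]\<close>)
  ultimately have "continuous_on UNIV (\<lambda>y. \<integral>x. ?f x \<partial>?M y)"
    unfolding eq Complex_eq by (intro continuous_intros)
  moreover have "cmod (\<integral>x. ?f x \<partial>?M y) \<le> B" for y
  proof -
    interpret prob_space "?M y" by (rule prob)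
    have "cmod (\<integral>x. ?f x \<partial>?M y) \<le> (\<integral>x. cmod (?f x) \<partial>?M y)" by (rule integral_norm_bound)
    also have "\<dots> \<le> (\<integral>x. B \<partial>?M y)" using int B by (intro integral_mono) auto
    finally show ?thesis using prob_space by simp
  qed
  ultimately show ?thesis by (auto simp: bcontfun_def bounded_iff)
qed

context semihypergroup
begin

lemma continuous_map_conv_point_masses:
  "continuous_map euclidean cone_topology (\<lambda>y. conv (point_mass x) (point_mass y))"
  "continuous_map euclidean cone_topology (\<lambda>y. conv (point_mass y) (point_mass x))"
proof -
  have "continuous_map euclidean (prod_topology cone_topology cone_topology) (\<lambda>y. (point_mass (x::'a), point_mass (y::'a)))"
    "continuous_map euclidean (prod_topology cone_topology cone_topology) (\<lambda>y. (point_mass (y::'a), point_mass (x::'a)))"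
    by (simp_all add: continuous_map_pairwise o_def continuous_map_point_mass point_mass_nonneg_reg)
  from this[THEN continuous_map_compose, OF conv_continuous]
  show "continuous_map euclidean cone_topology (\<lambda>y. conv (point_mass x) (point_mass y))"
    "continuous_map euclidean cone_topology (\<lambda>y. conv (point_mass y) (point_mass x))"
    by (simp_all add: o_def)
qed

lemma apply_left_translate:
  "apply_bcontfun (left_translate conv x f) y = conv_eval conv (apply_bcontfun f) x y"
  unfolding left_translate_def conv_eval_def
  using bcontfun_integral_cone[OF locally_compact continuous_map_conv_point_masses(1) conv_point_masses_prob]
  by (subst Bcontfun_inverse) auto

lemma apply_right_translate:
  "apply_bcontfun (right_translate conv y f) x = conv_eval conv (apply_bcontfun f) x y"
  unfolding right_translate_def conv_eval_def
  using bcontfun_integral_cone[OF locally_compact continuous_map_conv_point_masses(2) conv_point_masses_prob]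
  by (subst Bcontfun_inverse) auto

end

end

theory Submission
  imports Defs
begin

text \<open>
  The two orbits of a bounded continuous function \<open>f\<close> are the rows and the columns of one bounded
  matrix: with \<open>F(x,y) = f(x * y)\<close>, the left translates are the functions \<open>F(x,\<cdot>)\<close> and the right
  translates the functions \<open>F(\<cdot>,y)\<close>. The theorem therefore follows from Grothendieck's
  observation that, for a bounded separately continuous function of two variables, the rows form a
  relatively weakly compact set of continuous functions if and only if the columns do
  (\<open>relatively_weakly_compact_transpose\<close>). The link between the two sides is the interchange of
  iterated limits, which does not distinguish rows from columns.

  If the columns are relatively weakly compact, then iterated limits of \<open>F\<close> along sequences
  \<open>x\<^sub>m\<close>, \<open>y\<^sub>n\<close> can be interchanged (\<open>iterated_limits_agree_if_columns_compact\<close>): both iterated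
  limits equal \<open>\<phi> h\<close>, where \<open>h\<close> is a weak cluster point of the columns \<open>F(\<cdot>,y\<^sub>n)\<close> and the
  functional \<open>\<phi>\<close> is a generalized limit along \<open>x\<^sub>m\<close>.

  Conversely, suppose that iterated limits can be interchanged, and let the rows \<open>F(x,\<cdot>)\<close> converge
  along a filter pointwise to \<open>g\<close>. Then \<open>g\<close> is continuous (\<open>continuous_pointwise_limit\<close>): a
  discontinuity would allow one to pick, by turns, rows and points that violate the interchange.
  Moreover \<open>\<Phi>(F(x,\<cdot>))\<close> converges to \<open>\<Phi>(g)\<close> for every bounded functional \<open>\<Phi>\<close>
  (\<open>tendsto_bounded_linear_if_pointwise\<close>). This is the heart of the matter, as dominated
  convergence fails for filters. If it fails here, then frequently the difference \<open>F(x,\<cdot>) - g\<close> is not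
  small in the mean with respect to the total variation of \<open>\<Phi>\<close>. In a finite
  measure space, infinitely many sets with measures bounded below cannot be almost disjoint, so rows \<open>x\<^sub>0, x\<^sub>1, \<dots>\<close> can be chosen successively such that for
  every \<open>n\<close> some point \<open>y\<^sub>n\<close> has all of \<open>F(x\<^sub>0,\<cdot>) - g, \<dots>, F(x\<^sub>n,\<cdot>) - g\<close> bounded away from zero at
  it, while the later rows are already close to \<open>g\<close> at \<open>y\<^sub>n\<close>; again the interchange is violated.
  Weak compactness of the rows follows from these two facts by Tychonoff's theorem, applied to the
  embedding of the space of bounded continuous functions into the product over its dual.
\<close>

section \<open>Interchange of iterated limits\<close>

text \<open>Stated with closed sets, the condition speaks about all cluster values at once, and no
  subsequence along which the iterated limits exist has to be extracted first.\<close>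

definition iterated_limits_agree :: "('x \<Rightarrow> 'y \<Rightarrow> 'b::topological_space) \<Rightarrow> bool" where
  "iterated_limits_agree F \<longleftrightarrow>
     (\<forall>(x :: nat \<Rightarrow> 'x) (y :: nat \<Rightarrow> 'y) A B. closed A \<longrightarrow> closed B \<longrightarrow>
        (\<forall>n. \<forall>i\<le>n. F (x i) (y n) \<in> A) \<longrightarrow> (\<forall>n. \<forall>m>n. F (x m) (y n) \<in> B) \<longrightarrow> A \<inter> B \<noteq> {})"

lemma iterated_limits_agreeD:
  fixes x :: "nat \<Rightarrow> 'x" and y :: "nat \<Rightarrow> 'y"
  assumes "iterated_limits_agree F" "closed A" "closed B"
    and "\<And>n i. i \<le> n \<Longrightarrow> F (x i) (y n) \<in> A" and "\<And>n m. n < m \<Longrightarrow> F (x m) (y n) \<in> B"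
  shows "A \<inter> B \<noteq> {}"
  using assms unfolding iterated_limits_agree_def by metis

text \<open>If \<open>g\<close> jumps at \<open>y0\<close>, choose by turns rows \<open>x\<^sub>n\<close> that approximate \<open>g\<close> at \<open>y0\<close> and at the
  earlier points, and points \<open>y\<^sub>n\<close> at which \<open>g\<close> differs from \<open>g y0\<close> while the rows chosen so far
  barely differ from their values at \<open>y0\<close>. Then \<open>F (x\<^sub>i) (y\<^sub>n)\<close> is close to \<open>g y0\<close> for \<open>i \<le> n\<close>
  and far from it for \<open>i > n\<close>.\<close>

lemma continuous_pointwise_limit:
  fixes F :: "'x \<Rightarrow> 'y::topological_space \<Rightarrow> 'b::metric_space"
  assumes agree: "iterated_limits_agree F" and cont: "\<And>x. continuous_on UNIV (F x)"
    and G: "G \<noteq> bot" and lim: "\<And>y. ((\<lambda>x. F x y) \<longlongrightarrow> g y) G"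
  shows "continuous_on UNIV g"
proof (rule ccontr)
  assume "\<not> continuous_on UNIV g"
  then obtain y0 where "\<not> (g \<longlongrightarrow> g y0) (at y0)"
    by (auto simp: continuous_on_def)
  then have "\<not> (g \<longlongrightarrow> g y0) (nhds y0)"
    by (simp add: tendsto_at_iff_tendsto_nhds)
  then obtain e where e: "e > 0" and "\<not> (\<forall>\<^sub>F y in nhds y0. dist (g y) (g y0) < e)"
    by (auto simp: tendsto_iff)
  then have far: "\<exists>\<^sub>F y in nhds y0. e \<le> dist (g y) (g y0)"
    by (simp add: frequently_def not_le)
  have near_y0: "\<forall>\<^sub>F y in nhds y0. dist (F x y) (F x y0) < e / 4" for x
  proof -
    have "(F x \<longlongrightarrow> F x y0) (nhds y0)"
      using cont[of x] by (simp add: continuous_on_def flip: tendsto_at_iff_tendsto_nhds)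
    then show ?thesis using e by (intro tendstoD) auto
  qed
  have near_g: "\<forall>\<^sub>F x in G. dist (F x y) (g y) < e / 4" for y
    using e by (intro tendstoD[OF lim]) auto
  let ?P = "\<lambda>f n p. dist (F (fst p) y0) (g y0) < e / 4
      \<and> (\<forall>k\<in>{..<n}. dist (F (fst p) (snd (f k))) (g (snd (f k))) < e / 4)
      \<and> dist (F (fst p) (snd p)) (F (fst p) y0) < e / 4
      \<and> (\<forall>k\<in>{..<n}. dist (F (fst (f k)) (snd p)) (F (fst (f k)) y0) < e / 4)
      \<and> e \<le> dist (g (snd p)) (g y0)"
  have "\<exists>f :: nat \<Rightarrow> 'x \<times> 'y. \<forall>n. ?P f n (f n)"
  proof (rule dependent_wellorder_choice)
    fix n :: nat and f :: "nat \<Rightarrow> 'x \<times> 'y"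
    have "\<forall>\<^sub>F x in G. dist (F x y0) (g y0) < e / 4
        \<and> (\<forall>k\<in>{..<n}. dist (F x (snd (f k))) (g (snd (f k))) < e / 4)"
      by (intro eventually_conj eventually_ball_finite ballI near_g) auto
    then obtain x where x: "dist (F x y0) (g y0) < e / 4"
        "\<forall>k\<in>{..<n}. dist (F x (snd (f k))) (g (snd (f k))) < e / 4"
      using eventually_happens'[OF G] by blast
    have "\<forall>\<^sub>F y in nhds y0. dist (F x y) (F x y0) < e / 4
        \<and> (\<forall>k\<in>{..<n}. dist (F (fst (f k)) y) (F (fst (f k)) y0) < e / 4)"
      by (intro eventually_conj eventually_ball_finite ballI near_y0) auto
    from frequently_ex[OF frequently_eventually_conj[OF far this]] x
    show "\<exists>p. ?P f n p" by auto
  qed auto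
  then obtain f :: "nat \<Rightarrow> 'x \<times> 'y" where f: "\<And>n. ?P f n (f n)" by blast
  have "cball (g y0) (e / 2) \<inter> - ball (g y0) (3 * e / 4) \<noteq> {}"
  proof (rule iterated_limits_agreeD[OF agree])
    fix n i :: nat assume "i \<le> n"
    then have "dist (F (fst (f i)) (snd (f n))) (F (fst (f i)) y0) < e / 4"
      using f[of n] by (cases "i = n") auto
    then show "F (fst (f i)) (snd (f n)) \<in> cball (g y0) (e / 2)"
      using f[of i] dist_triangle[of "F (fst (f i)) (snd (f n))" "g y0" "F (fst (f i)) y0"]
      by (simp add: dist_commute)
  next
    fix n m :: nat assume "n < m"
    then have "dist (F (fst (f m)) (snd (f n))) (g (snd (f n))) < e / 4"
      using f[of m] by auto
    then show "F (fst (f m)) (snd (f n)) \<in> - ball (g y0) (3 * e / 4)"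
      using f[of n] dist_triangle[of "g (snd (f n))" "g y0" "F (fst (f m)) (snd (f n))"]
      by (simp add: dist_commute)
  qed auto
  then show False using e by auto
qed


section \<open>Positive functionals and recurrence\<close>

definition Cb_nonneg :: "('y::topological_space \<Rightarrow> real) set" where
  "Cb_nonneg = {h. continuous_on UNIV h \<and> (\<forall>y. 0 \<le> h y) \<and> (\<exists>C. \<forall>y. h y \<le> C)}"

lemma Cb_nonneg_const: "0 \<le> c \<Longrightarrow> (\<lambda>_. c) \<in> Cb_nonneg"
  by (auto simp: Cb_nonneg_def)

lemma Cb_nonneg_add:
  assumes "h \<in> Cb_nonneg" "k \<in> Cb_nonneg"
  shows "(\<lambda>y. h y + k y) \<in> Cb_nonneg"
proof -
  obtain C D where "\<forall>y. h y \<le> C" "\<forall>y. k y \<le> D"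
    using assms by (auto simp: Cb_nonneg_def)
  then have "\<forall>y. h y + k y \<le> C + D" by (simp add: add_mono)
  then show ?thesis using assms by (auto simp: Cb_nonneg_def intro!: continuous_intros)
qed

lemma Cb_nonneg_mult:
  assumes "h \<in> Cb_nonneg" "k \<in> Cb_nonneg"
  shows "(\<lambda>y. h y * k y) \<in> Cb_nonneg"
proof -
  obtain C D where "\<forall>y. h y \<le> C" "\<forall>y. k y \<le> D"
    using assms by (auto simp: Cb_nonneg_def)
  then have "\<forall>y. h y * k y \<le> C * D"
    using assms by (intro allI mult_mono) (auto simp: Cb_nonneg_def intro: order_trans)
  then show ?thesis using assms by (auto simp: Cb_nonneg_def intro!: continuous_intros)
qed

lemma Cb_nonneg_sum:
  "(\<And>i. i \<in> I \<Longrightarrow> h i \<in> Cb_nonneg) \<Longrightarrow> (\<lambda>y. \<Sum>i\<in>I. h i y) \<in> Cb_nonneg"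
  by (induction I rule: infinite_finite_induct) (auto intro: Cb_nonneg_const Cb_nonneg_add)

text \<open>Bonferroni's inequality for the probability of a union of independent events; it is applied
  to function values in place of indicators.\<close>

lemma bonferroni:
  fixes u :: "nat \<Rightarrow> real"
  assumes "\<And>i. 0 \<le> u i" "\<And>i. u i \<le> 1"
  shows "(\<Sum>i<n. u i) \<le> 1 + (\<Sum>j<n. \<Sum>i<j. u i * u j)"
proof (induction n)
  case (Suc n)
  define S Q where "S = (\<Sum>i<n. u i)" and "Q = (\<Sum>j<n. \<Sum>i<j. u i * u j)"
  have Q: "0 \<le> Q" "S \<le> 1 + Q"
    using Suc assms by (auto simp: S_def Q_def intro!: sum_nonneg)
  have "S + u n \<le> 1 + Q + S * u n"
  proof (cases "S \<ge> 1")
    case True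
    then have "u n \<le> S * u n" using assms(1)[of n] mult_right_mono[of 1 S "u n"] by simp
    then show ?thesis using Q by simp
  next
    case False
    then have "(1 - S) * u n \<le> 1 - S" using assms[of n] by (intro mult_left_le) auto
    then show ?thesis using Q by (simp add: algebra_simps)
  qed
  then show ?case by (simp add: S_def Q_def sum_distrib_right)
qed simp

locale positive_functional =
  fixes \<Psi> :: "('y::topological_space \<Rightarrow> real) \<Rightarrow> real"
  assumes add: "\<lbrakk>h \<in> Cb_nonneg; k \<in> Cb_nonneg\<rbrakk> \<Longrightarrow> \<Psi> (\<lambda>y. h y + k y) = \<Psi> h + \<Psi> k"
    and mono: "\<lbrakk>h \<in> Cb_nonneg; k \<in> Cb_nonneg; \<And>y. h y \<le> k y\<rbrakk> \<Longrightarrow> \<Psi> h \<le> \<Psi> k"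
begin

lemma zero: "\<Psi> (\<lambda>_. 0) = 0"
  using add[of "\<lambda>_. 0" "\<lambda>_. 0"] by (simp add: Cb_nonneg_const)

lemma sum:
  "(\<And>i. i \<in> I \<Longrightarrow> h i \<in> Cb_nonneg) \<Longrightarrow> \<Psi> (\<lambda>y. \<Sum>i\<in>I. h i y) = (\<Sum>i\<in>I. \<Psi> (h i))"
  by (induction I rule: infinite_finite_induct) (simp_all add: zero add Cb_nonneg_sum)

definition recurrent :: "'x filter \<Rightarrow> ('x \<Rightarrow> 'y \<Rightarrow> real) \<Rightarrow> ('y \<Rightarrow> real) \<Rightarrow> bool" where
  "recurrent G u s \<longleftrightarrow> (\<exists>\<eta>>0. \<exists>\<^sub>F x in G. \<eta> \<le> \<Psi> (\<lambda>y. s y * u x y))"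

text \<open>This is the analogue, for filters, of the fact that among infinitely many events with
  probabilities bounded below some two must intersect substantially. Otherwise arbitrarily many
  functions \<open>s * u x\<close> of mean at least \<open>\<eta>\<close> with negligible products could be collected, and
  Bonferroni's inequality would make the sum of their means at most \<open>\<Psi> s + 1\<close>.\<close>

lemma recurrent_step:
  assumes rec: "recurrent G u s" and s: "s \<in> Cb_nonneg" and Q: "eventually Q G"
    and u: "\<And>x. u x \<in> Cb_nonneg" and u_le: "\<And>x y. u x y \<le> 1"
  shows "\<exists>x. Q x \<and> recurrent G u (\<lambda>y. s y * u x y)"
proof (rule ccontr)
  assume "\<not> ?thesis"
  then have small: "\<forall>\<^sub>F x' in G. \<Psi> (\<lambda>y. s y * u x y * u x' y) < \<zeta>" if "Q x" "\<zeta> > 0" for x \<zeta>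
    using that by (auto simp: recurrent_def not_frequently not_le)
  obtain \<eta> where \<eta>: "\<eta> > 0" "\<exists>\<^sub>F x in G. \<eta> \<le> \<Psi> (\<lambda>y. s y * u x y)"
    using rec by (auto simp: recurrent_def)
  obtain N0 where N0: "\<Psi> s + 1 < real N0 * \<eta>"
    using reals_Archimedean3[OF \<eta>(1)] by blast
  define N where "N = Suc N0"
  have N: "\<Psi> s + 1 < real N * \<eta>" "N > 0"
    using N0 \<eta>(1) by (auto simp: N_def algebra_simps)
  define \<zeta> where "\<zeta> = 1 / (real N * real N)"
  have \<zeta>: "\<zeta> > 0" using N by (simp add: \<zeta>_def)
  let ?P = "\<lambda>f n x. Q x \<and> \<eta> \<le> \<Psi> (\<lambda>y. s y * u x y) \<and>
    (\<forall>k\<in>{..<n}. \<Psi> (\<lambda>y. s y * u (f k) y * u x y) < \<zeta>)"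
  have "\<exists>f :: nat \<Rightarrow> 'a. \<forall>n. ?P f n (f n)"
  proof (rule dependent_wellorder_choice)
    fix n :: nat and f :: "nat \<Rightarrow> 'a"
    assume "\<And>k. k < n \<Longrightarrow> ?P f k (f k)"
    then have "\<forall>\<^sub>F x in G. Q x \<and> (\<forall>k\<in>{..<n}. \<Psi> (\<lambda>y. s y * u (f k) y * u x y) < \<zeta>)"
      using \<zeta> by (intro eventually_conj Q eventually_ball_finite ballI small) auto
    from frequently_ex[OF frequently_eventually_conj[OF \<eta>(2) this]]
    show "\<exists>x. ?P f n x" by auto
  qed auto
  then obtain f :: "nat \<Rightarrow> 'a" where f: "\<And>n. ?P f n (f n)" by blast
  let ?S = "\<lambda>y. \<Sum>i<N. s y * u (f i) y"
    and ?Q = "\<lambda>y. \<Sum>j<N. \<Sum>i<j. s y * u (f i) y * u (f j) y"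
  have SQ: "?S \<in> Cb_nonneg" "?Q \<in> Cb_nonneg"
    by (intro Cb_nonneg_sum Cb_nonneg_mult s u)+
  have "real N * \<eta> \<le> (\<Sum>i<N. \<Psi> (\<lambda>y. s y * u (f i) y))"
    using sum_bounded_below[of "{..<N}" \<eta> "\<lambda>i. \<Psi> (\<lambda>y. s y * u (f i) y)"] f by simp
  also have "\<dots> = \<Psi> ?S"
    by (intro sum[symmetric] Cb_nonneg_mult s u)
  also have "\<dots> \<le> \<Psi> (\<lambda>y. s y + ?Q y)"
  proof (intro mono SQ Cb_nonneg_add s)
    fix y
    have "s y * (\<Sum>i<N. u (f i) y) \<le> s y * (1 + (\<Sum>j<N. \<Sum>i<j. u (f i) y * u (f j) y))"
      using s u u_le by (intro mult_left_mono bonferroni) (auto simp: Cb_nonneg_def)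
    then show "?S y \<le> s y + ?Q y"
      by (simp add: sum_distrib_left distrib_left mult.assoc)
  qed
  also have "\<dots> = \<Psi> s + \<Psi> ?Q" by (intro add SQ s)
  also have "\<Psi> ?Q = (\<Sum>j<N. \<Sum>i<j. \<Psi> (\<lambda>y. s y * u (f i) y * u (f j) y))"
    by (subst sum) (auto intro!: sum.cong sum Cb_nonneg_sum Cb_nonneg_mult s u)
  also have "\<dots> \<le> (\<Sum>j<N. \<Sum>i<N. \<zeta>)"
  proof (intro sum_mono)
    fix j assume j: "j \<in> {..<N}"
    have "(\<Sum>i<j. \<Psi> (\<lambda>y. s y * u (f i) y * u (f j) y)) \<le> (\<Sum>i<j. \<zeta>)"
      using f[of j] by (intro sum_mono) (auto intro: less_imp_le)
    also have "\<dots> \<le> (\<Sum>i<N. \<zeta>)" using j \<zeta> by (intro sum_mono2) auto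
    finally show "(\<Sum>i<j. \<Psi> (\<lambda>y. s y * u (f i) y * u (f j) y)) \<le> (\<Sum>i<N. \<zeta>)" .
  qed
  also have "\<dots> = 1" using N by (simp add: \<zeta>_def)
  finally show False using N by simp
qed

text \<open>Iterating the previous lemma keeps the products \<open>u (x 0) * \<dots> * u (x n)\<close> recurrent and hence
  nonzero somewhere, while each new row can be required to satisfy the finitely many eventual
  conditions that come from the points found so far.\<close>

lemma recurrent_sequence:
  assumes rec: "recurrent G u (\<lambda>_. 1)" and R: "\<And>y. \<forall>\<^sub>F x in G. R x y"
    and u: "\<And>x. u x \<in> Cb_nonneg" and u_le: "\<And>x y. u x y \<le> 1"
  obtains x :: "nat \<Rightarrow> 'x" and y :: "nat \<Rightarrow> 'y"
  where "\<And>n i. i \<le> n \<Longrightarrow> 0 < u (x i) (y n)" "\<And>n m. n < m \<Longrightarrow> R (x m) (y n)"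
proof -
  have prod: "(\<lambda>y. \<Prod>k<n. u (x k) y) \<in> Cb_nonneg" for n and x :: "nat \<Rightarrow> 'x"
    by (induction n) (auto intro: Cb_nonneg_const Cb_nonneg_mult u)
  have pos: "\<exists>y. 0 < s y" if "recurrent G u s" "s \<in> Cb_nonneg" for s
  proof (rule ccontr)
    assume "\<not> (\<exists>y. 0 < s y)"
    then have "s = (\<lambda>_. 0)"
      using that by (auto simp: Cb_nonneg_def fun_eq_iff intro: antisym simp: not_less)
    then show False using that(1) by (auto simp: recurrent_def zero dest: frequently_ex)
  qed
  let ?s = "\<lambda>f n p y. (\<Prod>k<n. u (fst (f k)) y) * u (fst p) y"
  let ?P = "\<lambda>f n p. recurrent G u (?s f n p) \<and> 0 < ?s f n p (snd p) \<and>
    (\<forall>k\<in>{..<n}. R (fst p) (snd (f k)))"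
  have "\<exists>f :: nat \<Rightarrow> 'x \<times> 'y. \<forall>n. ?P f n (f n)"
  proof (rule dependent_wellorder_choice)
    fix n :: nat and f :: "nat \<Rightarrow> 'x \<times> 'y"
    assume IH: "\<And>k. k < n \<Longrightarrow> ?P f k (f k)"
    have "recurrent G u (\<lambda>y. \<Prod>k<n. u (fst (f k)) y)"
      using IH rec by (cases n) auto
    moreover have "\<forall>\<^sub>F x in G. \<forall>k\<in>{..<n}. R x (snd (f k))"
      by (intro eventually_ball_finite ballI R) auto
    ultimately obtain x where x: "\<forall>k\<in>{..<n}. R x (snd (f k))"
        "recurrent G u (\<lambda>y. (\<Prod>k<n. u (fst (f k)) y) * u x y)"
      using recurrent_step[of G u "\<lambda>y. \<Prod>k<n. u (fst (f k)) y", OF _ prod _ u u_le] by blast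
    moreover obtain y where "0 < (\<Prod>k<n. u (fst (f k)) y) * u x y"
      using pos[OF x(2) Cb_nonneg_mult[OF prod u]] by blast
    ultimately have "?P f n (x, y)" by simp
    then show "\<exists>p. ?P f n p" by blast
  next
    fix p :: "'x \<times> 'y" and f g :: "nat \<Rightarrow> 'x \<times> 'y" and n :: nat
    assume eq: "\<And>k. k < n \<Longrightarrow> f k = g k"
    then have "?s f n p = ?s g n p" by (auto intro!: ext prod.cong)
    then show "?P f n p = ?P g n p" using eq by auto
  qed
  then obtain f :: "nat \<Rightarrow> 'x \<times> 'y" where f: "\<And>n. ?P f n (f n)" by blast
  show thesis
  proof (rule that[of "\<lambda>n. fst (f n)" "\<lambda>n. snd (f n)"])
    fix n i :: nat assume i: "i \<le> n"
    have "(\<Prod>k<n. u (fst (f k)) (snd (f n))) * u (fst (f n)) (snd (f n)) \<noteq> 0"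
      using f[of n] by (metis less_irrefl)
    then have "u (fst (f i)) (snd (f n)) \<noteq> 0"
      using i by (cases "i = n") auto
    then show "0 < u (fst (f i)) (snd (f n))"
      using u by (auto simp: Cb_nonneg_def order_less_le)
  next
    fix n m :: nat assume "n < m"
    then show "R (fst (f m)) (snd (f n))" using f[of m] by auto
  qed
qed

end


section \<open>Weak convergence from pointwise convergence\<close>

text \<open>The total variation of a functional, restricted to nonnegative continuous functions, where it
  is additive.\<close>

definition variation ::
    "(('y::topological_space \<Rightarrow>\<^sub>C 'b::real_normed_vector) \<Rightarrow> real) \<Rightarrow> ('y \<Rightarrow> real) \<Rightarrow> real" where
  "variation \<Phi> h = (SUP v \<in> {v. \<forall>y. norm (apply_bcontfun v y) \<le> h y}. \<Phi> v)"

lemma variation_upper: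
  fixes \<Phi> :: "('y::topological_space \<Rightarrow>\<^sub>C 'b::real_normed_vector) \<Rightarrow> real"
  assumes "bounded_linear \<Phi>" "h \<in> Cb_nonneg" "\<And>y. norm (apply_bcontfun v y) \<le> h y"
  shows "\<Phi> v \<le> variation \<Phi> h"
proof -
  obtain K where K: "K > 0" "\<And>v. norm (\<Phi> v) \<le> norm v * K"
    using bounded_linear.pos_bounded[OF assms(1)] by blast
  obtain C where C: "\<And>y. h y \<le> C" using assms(2) by (auto simp: Cb_nonneg_def)
  have "\<Phi> v \<le> C * K" if "\<And>y. norm (apply_bcontfun v y) \<le> h y" for v
  proof -
    have "norm v \<le> C" using that C by (intro norm_bound) (rule order_trans)
    then have "norm v * K \<le> C * K" using K(1) by simp
    then show ?thesis using K(2)[of v] by simp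
  qed
  then show ?thesis
    unfolding variation_def using assms(3) by (intro cSUP_upper bdd_aboveI2) auto
qed

lemma variation_least:
  fixes \<Phi> :: "('y::topological_space \<Rightarrow>\<^sub>C 'b::real_normed_vector) \<Rightarrow> real"
  assumes "h \<in> Cb_nonneg"
    and "\<And>v. (\<And>y. norm (apply_bcontfun v y) \<le> h y) \<Longrightarrow> \<Phi> v \<le> c"
  shows "variation \<Phi> h \<le> c"
proof -
  have "{v. \<forall>y. norm (apply_bcontfun v y) \<le> h y} \<noteq> {}"
    using assms(1) by (auto simp: Cb_nonneg_def intro!: exI[of _ 0])
  then show ?thesis unfolding variation_def using assms(2) by (intro cSUP_least) auto
qed

text \<open>Subadditivity needs a continuous splitting of a function bounded by \<open>h + k\<close> into one bounded
  by \<open>h\<close> and one bounded by \<open>k\<close>. The natural weights \<open>h / (h + k)\<close> and \<open>k / (h + k)\<close> may be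
  discontinuous where \<open>h + k\<close> vanishes; adding \<open>\<epsilon>\<close> to the denominator repairs this at the cost of a
  remainder of norm at most \<open>\<epsilon>\<close>.\<close>

lemma positive_functional_variation:
  fixes \<Phi> :: "('y::topological_space \<Rightarrow>\<^sub>C 'b::real_normed_vector) \<Rightarrow> real"
  assumes lin: "bounded_linear \<Phi>"
  shows "positive_functional (variation \<Phi>)"
proof
  interpret bounded_linear \<Phi> by (rule lin)
  fix h k :: "'y \<Rightarrow> real" assume h: "h \<in> Cb_nonneg" and k: "k \<in> Cb_nonneg"
  note hk = Cb_nonneg_add[OF h k]
  show "variation \<Phi> (\<lambda>y. h y + k y) = variation \<Phi> h + variation \<Phi> k"
  proof (rule antisym)
    have "variation \<Phi> h \<le> variation \<Phi> (\<lambda>y. h y + k y) - variation \<Phi> k"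
    proof (rule variation_least[OF h])
      fix v :: "'y \<Rightarrow>\<^sub>C 'b" assume v: "\<And>y. norm (apply_bcontfun v y) \<le> h y"
      have "variation \<Phi> k \<le> variation \<Phi> (\<lambda>y. h y + k y) - \<Phi> v"
      proof (rule variation_least[OF k])
        fix w :: "'y \<Rightarrow>\<^sub>C 'b" assume w: "\<And>y. norm (apply_bcontfun w y) \<le> k y"
        have "\<Phi> (v + w) \<le> variation \<Phi> (\<lambda>y. h y + k y)"
          using v w by (intro variation_upper[OF lin hk]) (auto intro!: norm_triangle_mono)
        then show "\<Phi> w \<le> variation \<Phi> (\<lambda>y. h y + k y) - \<Phi> v" by (simp add: add)
      qed
      then show "\<Phi> v \<le> variation \<Phi> (\<lambda>y. h y + k y) - variation \<Phi> k" by simp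
    qed
    then show "variation \<Phi> h + variation \<Phi> k \<le> variation \<Phi> (\<lambda>y. h y + k y)" by simp
  next
    show "variation \<Phi> (\<lambda>y. h y + k y) \<le> variation \<Phi> h + variation \<Phi> k"
    proof (rule variation_least[OF hk], rule field_le_epsilon)
      fix v :: "'y \<Rightarrow>\<^sub>C 'b" and e :: real
      assume v: "\<And>y. norm (apply_bcontfun v y) \<le> h y + k y" and e: "0 < e"
      obtain K where K: "K > 0" "\<And>v. norm (\<Phi> v) \<le> norm v * K"
        using pos_bounded by blast
      define \<epsilon> where "\<epsilon> = e / K"
      have \<epsilon>: "\<epsilon> > 0" using e K by (simp add: \<epsilon>_def)
      have denom: "0 < h y + k y + \<epsilon>" for y
        using h k \<epsilon> by (auto simp: Cb_nonneg_def add_nonneg_pos)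
      define part where "part p = Bcontfun (\<lambda>y. (p y / (h y + k y + \<epsilon>)) *\<^sub>R apply_bcontfun v y)"
        for p :: "'y \<Rightarrow> real"
      have part_le: "norm ((p y / (h y + k y + \<epsilon>)) *\<^sub>R apply_bcontfun v y) \<le> p y"
        if "p \<in> Cb_nonneg" for p y
      proof -
        have p: "0 \<le> p y" using that by (simp add: Cb_nonneg_def)
        have "p y * norm (apply_bcontfun v y) \<le> p y * (h y + k y + \<epsilon>)"
          using p v[of y] \<epsilon> by (intro mult_left_mono) auto
        then show ?thesis using p denom[of y] by (simp add: field_simps)
      qed
      have part: "apply_bcontfun (part p) y = (p y / (h y + k y + \<epsilon>)) *\<^sub>R apply_bcontfun v y"
        if p: "p \<in> Cb_nonneg" for p y
      proof -
        obtain C where C: "\<And>y. p y \<le> C" using p by (auto simp: Cb_nonneg_def)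
        have "h y + k y + \<epsilon> \<noteq> 0" for y using denom[of y] by simp
        then have "continuous_on UNIV (\<lambda>y. (p y / (h y + k y + \<epsilon>)) *\<^sub>R apply_bcontfun v y)"
          using p h k by (auto simp: Cb_nonneg_def intro!: continuous_intros)
        then have "(\<lambda>y. (p y / (h y + k y + \<epsilon>)) *\<^sub>R apply_bcontfun v y) \<in> bcontfun"
          using part_le[OF p] C by (intro bcontfun_normI[of _ C]) (blast intro: order_trans)+
        then show ?thesis by (simp add: part_def Bcontfun_inverse)
      qed
      have c\<epsilon>: "(\<lambda>_. \<epsilon>) \<in> Cb_nonneg" using \<epsilon> by (simp add: Cb_nonneg_const)
      have "v = part h + part k + part (\<lambda>_. \<epsilon>)"
      proof (rule bcontfun_eqI)
        fix y
        have "h y + k y + \<epsilon> \<noteq> 0" using denom[of y] by simp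
        then show "apply_bcontfun v y = apply_bcontfun (part h + part k + part (\<lambda>_. \<epsilon>)) y"
          by (simp add: part h k c\<epsilon> flip: scaleR_add_left add_divide_distrib)
      qed
      then have "\<Phi> v = \<Phi> (part h) + \<Phi> (part k) + \<Phi> (part (\<lambda>_. \<epsilon>))" by (metis add)
      moreover have "\<Phi> (part h) \<le> variation \<Phi> h" "\<Phi> (part k) \<le> variation \<Phi> k"
        using part_le by (auto intro!: variation_upper lin h k simp: part[OF h] part[OF k] h k
            simp del: norm_scaleR)
      moreover have "\<Phi> (part (\<lambda>_. \<epsilon>)) \<le> e"
      proof -
        have "norm (part (\<lambda>_. \<epsilon>)) \<le> \<epsilon>"
          using part_le[OF c\<epsilon>] by (intro norm_bound) (simp add: part[OF c\<epsilon>] del: norm_scaleR)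
        then have "norm (part (\<lambda>_. \<epsilon>)) * K \<le> e" using K(1) by (simp add: \<epsilon>_def field_simps)
        then show ?thesis using K(2)[of "part (\<lambda>_. \<epsilon>)"] by simp
      qed
      ultimately show "\<Phi> v \<le> variation \<Phi> h + variation \<Phi> k + e" by simp
    qed
  qed
next
  fix h k :: "'y \<Rightarrow> real"
  assume "h \<in> Cb_nonneg" "k \<in> Cb_nonneg" "\<And>y. h y \<le> k y"
  then show "variation \<Phi> h \<le> variation \<Phi> k"
    by (intro variation_least variation_upper lin) (auto intro: order_trans)
qed

text \<open>Suppose the values of \<open>\<Phi>\<close> frequently exceed \<open>\<Phi> g\<close> by \<open>e\<close>. Since the total variation of
  \<open>\<Phi>\<close> gives the constant \<open>d\<close> only half of the necessary mass, the excess of \<open>|f x - g|\<close> over \<open>d\<close> is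
  recurrent. The resulting points and rows show that \<open>f x - g\<close> does not satisfy the interchange of
  iterated limits; passing to a subsequence along which \<open>g (y n)\<close> converges, the same holds for \<open>f\<close>.\<close>

lemma eventually_bounded_linear_less:
  fixes f :: "'x \<Rightarrow> ('y::topological_space \<Rightarrow>\<^sub>C 'b::{real_normed_vector, heine_borel})"
    and \<Phi> :: "('y \<Rightarrow>\<^sub>C 'b) \<Rightarrow> real"
  assumes agree: "iterated_limits_agree (\<lambda>x. apply_bcontfun (f x))"
    and bdd: "\<And>x. norm (f x) \<le> B"
    and lim: "\<And>y. ((\<lambda>x. apply_bcontfun (f x) y) \<longlongrightarrow> apply_bcontfun g y) G"
    and lin: "bounded_linear \<Phi>" and e: "e > 0"
  shows "\<forall>\<^sub>F x in G. \<Phi> (f x) < \<Phi> g + e"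
proof (rule ccontr)
  assume "\<not> ?thesis"
  then have freq: "\<exists>\<^sub>F x in G. \<Phi> g + e \<le> \<Phi> (f x)"
    by (simp add: frequently_def not_le)
  interpret bounded_linear \<Phi> by (rule lin)
  interpret V: positive_functional "variation \<Phi>"
    by (rule positive_functional_variation[OF lin])
  obtain K where K: "K > 0" "\<And>v. norm (\<Phi> v) \<le> norm v * K"
    using pos_bounded by blast
  \<comment> \<open>Division by \<open>C\<close> brings the differences into the unit ball, as \<open>recurrent_sequence\<close> requires.\<close>
  define C where "C = B + norm g + 1"
  have C: "C > 0" "\<And>x. norm (f x - g) \<le> C"
  proof -
    have "0 \<le> B" using bdd[of undefined] norm_ge_zero order_trans by blast
    then show "C > 0" using norm_ge_zero[of g] unfolding C_def by linarith
    show "norm (f x - g) \<le> C" for x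
      using norm_triangle_ineq4[of "f x" g] bdd[of x] by (simp add: C_def)
  qed
  define w where "w x = (1 / C) *\<^sub>R (f x - g)" for x
  \<comment> \<open>The variation of the constant \<open>d\<close> is at most \<open>e / (2 * C)\<close>, half of what \<open>\<Phi> (w x)\<close>
    frequently reaches.\<close>
  define d where "d = e / (2 * C * K)"
  define u where "u x y = max 0 (norm (apply_bcontfun (w x) y) - d)" for x y
  have d: "d > 0" using e C K by (simp add: d_def)
  have w_apply: "norm (apply_bcontfun (w x) y) = dist (apply_bcontfun (f x) y) (apply_bcontfun g y) / C" for x y
    using C(1) by (simp add: w_def dist_norm)
  have w_le: "norm (apply_bcontfun (w x) y) \<le> 1" for x y
    using norm_bounded[of "f x - g" y] C(2)[of x] C(1) by (simp add: w_apply dist_norm)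
  have u_le: "u x y \<le> 1" for x y using w_le[of x y] d by (simp add: u_def)
  have u: "u x \<in> Cb_nonneg" for x
  proof -
    have "continuous_on UNIV (u x)" unfolding u_def by (intro continuous_intros) auto
    moreover have "0 \<le> u x y" for y by (simp add: u_def)
    ultimately show ?thesis using u_le unfolding Cb_nonneg_def by blast
  qed
  have rec: "V.recurrent G u (\<lambda>_. 1)"
    unfolding V.recurrent_def
  proof (intro exI conjI)
    show "e / (2 * C) > 0" using e C by simp
    show "\<exists>\<^sub>F x in G. e / (2 * C) \<le> variation \<Phi> (\<lambda>y. 1 * u x y)"
      using freq
    proof (rule frequently_elim1)
      fix x assume x: "\<Phi> g + e \<le> \<Phi> (f x)"
      have dC: "(\<lambda>_. d) \<in> Cb_nonneg" using d by (simp add: Cb_nonneg_const)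
      have "e / C \<le> (\<Phi> (f x) - \<Phi> g) / C" using x C(1) by (simp add: divide_right_mono)
      also have "\<dots> = \<Phi> (w x)" by (simp add: w_def scaleR diff)
      also have "\<dots> \<le> variation \<Phi> (\<lambda>y. u x y + d)"
        by (rule variation_upper[OF lin Cb_nonneg_add[OF u dC]]) (simp add: u_def max_def)
      also have "\<dots> = variation \<Phi> (u x) + variation \<Phi> (\<lambda>_. d)" by (intro V.add u dC)
      also have "variation \<Phi> (\<lambda>_. d) \<le> d * K"
      proof (rule variation_least[OF dC])
        fix v :: "'y \<Rightarrow>\<^sub>C 'b" assume "\<And>y. norm (apply_bcontfun v y) \<le> d"
        then have "norm v * K \<le> d * K" using K(1) by (simp add: norm_bound)
        then show "\<Phi> v \<le> d * K" using K(2)[of v] by simp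
      qed
      also have "d * K = e / (2 * C)" using K(1) by (simp add: d_def)
      finally show "e / (2 * C) \<le> variation \<Phi> (\<lambda>y. 1 * u x y)" using C(1) by (simp add: field_simps)
    qed
  qed
  have "\<forall>\<^sub>F x in G. dist (apply_bcontfun (f x) y) (apply_bcontfun g y) < C * d / 2" for y
    using C(1) d by (intro tendstoD[OF lim]) simp
  then obtain x :: "nat \<Rightarrow> 'x" and y :: "nat \<Rightarrow> 'y"
    where x_far: "\<And>n i. i \<le> n \<Longrightarrow> 0 < u (x i) (y n)"
      and x_near: "\<And>n m. n < m \<Longrightarrow>
        dist (apply_bcontfun (f (x m)) (y n)) (apply_bcontfun g (y n)) < C * d / 2"
    using V.recurrent_sequence[where R = "\<lambda>x y. dist (apply_bcontfun (f x) y) (apply_bcontfun g y) < C * d / 2",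
        OF rec _ u u_le] by blast
  have x_far': "C * d < dist (apply_bcontfun (f (x i)) (y n)) (apply_bcontfun g (y n))" if "i \<le> n" for i n
  proof -
    have "d < norm (apply_bcontfun (w (x i)) (y n))"
      using x_far[OF that] by (auto simp: u_def max_def split: if_splits)
    then show ?thesis using C(1) by (simp add: w_apply pos_less_divide_eq mult.commute)
  qed
  have "bounded (range (\<lambda>n. apply_bcontfun g (y n)))"
    by (rule bounded_subset[OF bounded_apply_bcontfun[of g]]) auto
  then obtain c r where r: "strict_mono r" "(\<lambda>n. apply_bcontfun g (y (r n))) \<longlonglongrightarrow> c"
    using bounded_imp_convergent_subsequence[of "\<lambda>n. apply_bcontfun g (y n)"]
    by (auto simp: o_def)
  have "0 < C * d / 8" using C(1) d by simp
  then obtain N where N: "\<And>n. N \<le> n \<Longrightarrow> dist (apply_bcontfun g (y (r n))) c < C * d / 8"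
    using tendstoD[OF r(2)] unfolding eventually_sequentially by blast
  \<comment> \<open>Replacing \<open>g (y (r n))\<close> by its limit \<open>c\<close> costs \<open>C * d / 8\<close> in each of the bounds \<open>C * d\<close>
    and \<open>C * d / 2\<close>.\<close>
  have "- ball c (7 * (C * d) / 8) \<inter> cball c (5 * (C * d) / 8) \<noteq> {}"
  proof (rule iterated_limits_agreeD[OF agree])
    fix n i :: nat assume "i \<le> n"
    then have "r (N + i) \<le> r (N + n)" using r(1) by (simp add: strict_mono_less_eq)
    from x_far'[OF this] N[of "N + n"]
    show "apply_bcontfun (f (x (r (N + i)))) (y (r (N + n))) \<in> - ball c (7 * (C * d) / 8)"
      using dist_triangle[of "apply_bcontfun (f (x (r (N + i)))) (y (r (N + n)))"
          "apply_bcontfun g (y (r (N + n)))" c]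
      by (simp add: dist_commute)
  next
    fix n m :: nat assume "n < m"
    then have "r (N + n) < r (N + m)" using r(1) by (simp add: strict_mono_less)
    from x_near[OF this] N[of "N + n"]
    show "apply_bcontfun (f (x (r (N + m)))) (y (r (N + n))) \<in> cball c (5 * (C * d) / 8)"
      using dist_triangle[of "apply_bcontfun (f (x (r (N + m)))) (y (r (N + n)))" c
          "apply_bcontfun g (y (r (N + n)))"]
      by (simp add: dist_commute)
  qed auto
  then show False using \<open>0 < C * d / 8\<close> by auto
qed

lemma tendsto_bounded_linear_if_pointwise:
  fixes f :: "'x \<Rightarrow> ('y::topological_space \<Rightarrow>\<^sub>C 'b::{real_normed_vector, heine_borel})"
    and \<Phi> :: "('y \<Rightarrow>\<^sub>C 'b) \<Rightarrow> 'c::euclidean_space"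
  assumes agree: "iterated_limits_agree (\<lambda>x. apply_bcontfun (f x))"
    and bdd: "\<And>x. norm (f x) \<le> B"
    and lim: "\<And>y. ((\<lambda>x. apply_bcontfun (f x) y) \<longlongrightarrow> apply_bcontfun g y) G"
    and lin: "bounded_linear \<Phi>"
  shows "((\<lambda>x. \<Phi> (f x)) \<longlongrightarrow> \<Phi> g) G"
proof -
  have "((\<lambda>x. \<Phi> (f x) \<bullet> b) \<longlongrightarrow> \<Phi> g \<bullet> b) G" for b
  proof (rule tendstoI)
    fix e :: real assume e: "e > 0"
    have "bounded_linear (\<lambda>v. \<Phi> v \<bullet> b)" "bounded_linear (\<lambda>v. - (\<Phi> v \<bullet> b))"
      using bounded_linear_compose[OF bounded_linear_inner_left lin] bounded_linear_minus by auto
    from this[THEN eventually_bounded_linear_less[OF agree bdd lim], OF e]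
    show "\<forall>\<^sub>F x in G. dist (\<Phi> (f x) \<bullet> b) (\<Phi> g \<bullet> b) < e"
      by eventually_elim (simp add: dist_real_def)
  qed
  then show ?thesis by (subst tendsto_componentwise_iff) blast
qed


section \<open>Weakly compact sets of bounded continuous functions\<close>

lemma compact_Pi_UNIV:
  assumes "\<And>i. compact (S i)"
  shows "compact (Pi UNIV S)"
  using compactin_PiE[of "\<lambda>_. euclidean" UNIV S] assms
  by (simp add: euclidean_product_topology PiE_UNIV_domain)

lemma mem_closed_if_cluster_point:
  assumes cluster: "inf (nhds l) F \<noteq> bot" and "closed S" "\<forall>\<^sub>F x in F. x \<in> S"
  shows "l \<in> S"
proof (rule ccontr)
  assume "l \<notin> S"
  then have "\<forall>\<^sub>F x in nhds l. x \<in> - S"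
    using \<open>closed S\<close> by (intro eventually_nhds_in_open) auto
  then have "\<forall>\<^sub>F x in inf (nhds l) F. False"
    using assms(3) by (auto simp: eventually_inf)
  then show False using cluster by (simp add: trivial_limit_def)
qed

text \<open>A cluster point, in the pointwise topology, of the evaluations at \<open>x m\<close>; by Tychonoff's theorem
  it exists, and linearity is a closed condition.\<close>

lemma generalized_limit_exists:
  fixes x :: "nat \<Rightarrow> 'a::topological_space"
  obtains \<phi> where "\<phi> \<in> dual_bcontfun"
    and "\<And>f A. \<lbrakk>closed A; \<forall>\<^sub>F m in sequentially. apply_bcontfun f (x m) \<in> A\<rbrakk> \<Longrightarrow> \<phi> f \<in> A"
proof -
  define E where "E m f = apply_bcontfun f (x m)" for m and f :: "'a \<Rightarrow>\<^sub>C complex"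
  let ?K = "Pi UNIV (\<lambda>f :: 'a \<Rightarrow>\<^sub>C complex. cball (0 :: complex) (norm f))"
  have "compact ?K" by (intro compact_Pi_UNIV compact_cball)
  moreover have "filtermap E sequentially \<noteq> bot" by (simp add: filtermap_bot_iff)
  moreover have "\<forall>\<^sub>F \<psi> in filtermap E sequentially. \<psi> \<in> ?K"
    by (simp add: eventually_filtermap E_def norm_bounded)
  ultimately obtain \<phi> where \<phi>: "\<phi> \<in> ?K" "inf (nhds \<phi>) (filtermap E sequentially) \<noteq> bot"
    unfolding compact_filter by blast
  have closed: "\<phi> \<in> S" if "closed S" "\<forall>\<^sub>F m in sequentially. E m \<in> S" for S
    using that by (intro mem_closed_if_cluster_point[OF \<phi>(2)]) (auto simp: eventually_filtermap)
  have "\<phi> \<in> {\<psi>. \<psi> (f + g) = \<psi> f + \<psi> g}" for f g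
    by (rule closed) (auto simp: E_def intro!: closed_Collect_eq continuous_on_add)
  moreover have "\<phi> \<in> {\<psi>. \<psi> (r *\<^sub>R f) = r *\<^sub>R \<psi> f}" for r f
    by (rule closed) (auto simp: E_def intro!: closed_Collect_eq continuous_on_scaleR)
  ultimately have "bounded_linear \<phi>"
    using \<phi>(1) by (intro bounded_linear_intro[of _ 1]) auto
  moreover have "\<phi> \<in> {\<psi>. \<psi> g = c * \<psi> f}"
    if "\<forall>x. apply_bcontfun g x = c * apply_bcontfun f x" for c f g
    using that by (intro closed) (auto simp: E_def intro!: closed_Collect_eq continuous_on_mult)
  ultimately have "\<phi> \<in> dual_bcontfun" by (auto simp: dual_bcontfun_def)
  moreover have "\<phi> f \<in> A" if "closed A" "\<forall>\<^sub>F m in sequentially. apply_bcontfun f (x m) \<in> A" for f A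
    using closed[of "(\<lambda>\<psi>. \<psi> f) -` A"] closed_vimage[OF that(1) continuous_on_product_coordinates[of f]] that(2)
    by (simp add: E_def)
  ultimately show thesis by (rule that)
qed

lemma eval_in_dual: "(\<lambda>f. apply_bcontfun f x) \<in> dual_bcontfun"
  by (auto simp: dual_bcontfun_def norm_bounded intro!: bounded_linear_intro[of _ 1])

lemma topspace_weak_topology_bcontfun [simp]: "topspace weak_topology_bcontfun = UNIV"
  unfolding weak_topology_bcontfun_def topology_generated_by_topspace
  using eval_in_dual by blast

lemma continuous_map_dual:
  assumes "\<phi> \<in> dual_bcontfun"
  shows "continuous_map weak_topology_bcontfun euclidean \<phi>"
proof -
  have "openin weak_topology_bcontfun (\<phi> -` U)" if "open U" for U
    unfolding weak_topology_bcontfun_def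
    using assms that by (intro topology_generated_by_Basis) blast
  then show ?thesis by (simp add: continuous_map_def vimage_def)
qed

text \<open>The evaluations at points belong to the dual and separate functions.\<close>

lemma Hausdorff_weak_topology_bcontfun:
  "Hausdorff_space (weak_topology_bcontfun :: ('a::topological_space \<Rightarrow>\<^sub>C complex) topology)"
  unfolding Hausdorff_space_def
proof (intro allI impI)
  fix f g :: "'a \<Rightarrow>\<^sub>C complex"
  assume "f \<in> topspace weak_topology_bcontfun \<and> g \<in> topspace weak_topology_bcontfun \<and> f \<noteq> g"
  then obtain x where "apply_bcontfun f x \<noteq> apply_bcontfun g x" using bcontfun_eqI by blast
  then obtain U V where UV: "open U" "open V" "apply_bcontfun f x \<in> U" "apply_bcontfun g x \<in> V"
      "U \<inter> V = {}"
    using hausdorff by metis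
  have "openin weak_topology_bcontfun ((\<lambda>f. apply_bcontfun f x) -` W)" if "open W" for W
    using continuous_map_dual[OF eval_in_dual[of x]] that by (simp add: continuous_map_def vimage_def)
  with UV show "\<exists>U V. openin weak_topology_bcontfun U \<and> openin weak_topology_bcontfun V
      \<and> f \<in> U \<and> g \<in> V \<and> disjnt U V"
    by (intro exI[of _ "(\<lambda>f. apply_bcontfun f x) -` U"] exI[of _ "(\<lambda>f. apply_bcontfun f x) -` V"])
       (auto simp: disjnt_def)
qed

lemma weak_cluster_point_exists:
  fixes h :: "nat \<Rightarrow> ('a::topological_space \<Rightarrow>\<^sub>C complex)"
  assumes compact: "relatively_weakly_compact S" and h: "\<And>n. h n \<in> S"
  obtains l where "\<And>\<phi> A. \<lbrakk>\<phi> \<in> dual_bcontfun; closed A; \<forall>\<^sub>F n in sequentially. \<phi> (h n) \<in> A\<rbrakk> \<Longrightarrow> \<phi> l \<in> A"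
proof -
  let ?W = "weak_topology_bcontfun :: ('a \<Rightarrow>\<^sub>C complex) topology"
  let ?K = "?W closure_of S"
  let ?C = "\<lambda>N. ?W closure_of (h ` {N..})"
  have sub: "?C N \<subseteq> ?K" for N using h by (intro closure_of_mono) auto
  have "(\<Inter>N. ?C N) \<noteq> {}"
  proof (rule compact_space_imp_nest[of "subtopology ?W ?K"])
    show "compact_space (subtopology ?W ?K)"
      using compact by (simp add: relatively_weakly_compact_def compact_space_subtopology)
    show "closedin (subtopology ?W ?K) (?C N)" for N
      using sub[of N] by (intro closedin_subset_topspace) auto
    have "h ` {N..} \<subseteq> ?C N" for N by (intro closure_of_subset) simp
    then show "?C N \<noteq> {}" for N by blast
    show "decseq ?C" by (auto simp: decseq_def intro!: closure_of_mono)
  qed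
  then obtain l where l: "\<And>N. l \<in> ?C N" by auto
  show thesis
  proof (rule that)
    fix \<phi> :: "('a \<Rightarrow>\<^sub>C complex) \<Rightarrow> complex" and A
    assume \<phi>: "\<phi> \<in> dual_bcontfun" and A: "closed A" and "\<forall>\<^sub>F n in sequentially. \<phi> (h n) \<in> A"
    then obtain N where "\<And>n. N \<le> n \<Longrightarrow> \<phi> (h n) \<in> A" by (auto simp: eventually_sequentially)
    then have "?C N \<subseteq> {f \<in> topspace ?W. \<phi> f \<in> A}"
      using closedin_continuous_map_preimage[OF continuous_map_dual[OF \<phi>], of A] A
      by (intro closure_of_minimal) auto
    then show "\<phi> l \<in> A" using l[of N] by blast
  qed
qed

lemma iterated_limits_agree_if_columns_compact:
  fixes k :: "'y \<Rightarrow> ('x::topological_space \<Rightarrow>\<^sub>C complex)"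
  assumes compact: "relatively_weakly_compact (range k)"
  shows "iterated_limits_agree (\<lambda>x y. apply_bcontfun (k y) x)"
  unfolding iterated_limits_agree_def
proof (intro allI impI)
  fix x :: "nat \<Rightarrow> 'x" and y :: "nat \<Rightarrow> 'y" and A B :: "complex set"
  assume A: "closed A" "\<forall>n. \<forall>i\<le>n. apply_bcontfun (k (y n)) (x i) \<in> A"
    and B: "closed B" "\<forall>n. \<forall>m>n. apply_bcontfun (k (y n)) (x m) \<in> B"
  obtain h where h: "\<And>\<phi> A. \<lbrakk>\<phi> \<in> dual_bcontfun; closed A; \<forall>\<^sub>F n in sequentially. \<phi> (k (y n)) \<in> A\<rbrakk>
      \<Longrightarrow> \<phi> h \<in> A"
    using weak_cluster_point_exists[OF compact, of "\<lambda>n. k (y n)"] by blast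
  obtain \<phi> where \<phi>: "\<phi> \<in> dual_bcontfun"
      "\<And>f A. \<lbrakk>closed A; \<forall>\<^sub>F m in sequentially. apply_bcontfun f (x m) \<in> A\<rbrakk> \<Longrightarrow> \<phi> f \<in> A"
    using generalized_limit_exists by metis
  have "apply_bcontfun h (x i) \<in> A" for i
    using A by (intro h eval_in_dual) (auto intro: eventually_sequentiallyI[of i])
  then have "\<phi> h \<in> A" using A(1) by (intro \<phi>(2)) auto
  moreover have "\<phi> (k (y n)) \<in> B" for n
    using B by (intro \<phi>(2)) (auto intro: eventually_sequentiallyI[of "Suc n"])
  then have "\<phi> h \<in> B" using B(1) by (intro h \<phi>(1)) auto
  ultimately show "A \<inter> B \<noteq> {}" by blast
qed

text \<open>The space of bounded continuous functions, with its weak topology, embeds into the product of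
  copies of the complex plane over its dual. There the image of a bounded set has compact closure,
  so it suffices that each point of this closure is the image of some continuous function. The point
  is the limit of the images of the rows along a filter, and that function is their pointwise
  limit.\<close>

lemma rows_compact_if_iterated_limits_agree:
  fixes f :: "'x \<Rightarrow> ('y::topological_space \<Rightarrow>\<^sub>C complex)"
  assumes agree: "iterated_limits_agree (\<lambda>x. apply_bcontfun (f x))"
    and bdd: "\<And>x. norm (f x) \<le> B"
  shows "relatively_weakly_compact (range f)"
proof -
  let ?W = "weak_topology_bcontfun :: ('y \<Rightarrow>\<^sub>C complex) topology"
  \<comment> \<open>The index set is the type of all maps; the coordinates outside the dual carry no information
    and are set to 0.\<close>
  define J where "J v = (\<lambda>\<phi>. if \<phi> \<in> dual_bcontfun then \<phi> v else 0)" for v :: "'y \<Rightarrow>\<^sub>C complex"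
  define K where "K = closure (range (\<lambda>x. J (f x)))"
  have "compact K"
  proof -
    have "\<exists>c. \<forall>x. norm (J (f x) \<phi>) \<le> c" for \<phi>
    proof (cases "\<phi> \<in> dual_bcontfun")
      case True
      then interpret bounded_linear \<phi> by (simp add: dual_bcontfun_def)
      obtain c where c: "c > 0" "\<And>v. norm (\<phi> v) \<le> norm v * c" using pos_bounded by blast
      have "norm (\<phi> (f x)) \<le> B * c" for x
        using c(2)[of "f x"] mult_right_mono[OF bdd[of x], of c] c(1) by linarith
      then show ?thesis using True by (auto simp: J_def)
    qed (auto simp: J_def)
    then obtain c where c: "\<And>\<phi> x. norm (J (f x) \<phi>) \<le> c \<phi>" by metis
    let ?P = "Pi UNIV (\<lambda>\<phi>. cball (0 :: complex) (c \<phi>))"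
    have "compact ?P" by (intro compact_Pi_UNIV compact_cball)
    moreover have "?P = (\<Inter>\<phi>. (\<lambda>\<zeta>. \<zeta> \<phi>) -` cball 0 (c \<phi>))" by auto
    then have "closed ?P"
      by (auto intro!: closed_INT closed_vimage)
    then have "K \<subseteq> ?P"
      unfolding K_def using c by (intro closure_minimal) auto
    ultimately show ?thesis
      by (metis K_def closed_closure compact_Int_closed inf.absorb_iff2)
  qed
  have "\<exists>v. J v = \<xi>" if "\<xi> \<in> K" for \<xi>
  proof -
    define G where "G = filtercomap (\<lambda>x. J (f x)) (nhds \<xi>)"
    have G: "G \<noteq> bot"
      unfolding G_def
    proof (rule filtercomap_neq_bot)
      fix P assume "eventually P (nhds \<xi>)"
      then obtain U where U: "open U" "\<xi> \<in> U" "\<And>z. z \<in> U \<Longrightarrow> P z"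
        unfolding eventually_nhds by blast
      then have "U \<inter> range (\<lambda>x. J (f x)) \<noteq> {}"
        using \<open>\<xi> \<in> K\<close> open_Int_closure_eq_empty[OF U(1)] unfolding K_def by blast
      then show "\<exists>x. P (J (f x))" using U(3) by blast
    qed
    have lim: "((\<lambda>x. J (f x) \<phi>) \<longlongrightarrow> \<xi> \<phi>) G" for \<phi>
    proof -
      have "((\<lambda>x. J (f x)) \<longlongrightarrow> \<xi>) G" unfolding G_def by (rule filterlim_filtercomap)
      moreover have "((\<lambda>\<zeta>. \<zeta> \<phi>) \<longlongrightarrow> \<xi> \<phi>) (at \<xi>)"
        using continuous_on_product_coordinates[of \<phi>] by (auto simp: continuous_on_def simp del: continuous_on_product_coordinates)
      ultimately show ?thesis using tendsto_compose by blast
    qed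
    define g where "g y = \<xi> (\<lambda>v. apply_bcontfun v y)" for y
    have lim_g: "((\<lambda>x. apply_bcontfun (f x) y) \<longlongrightarrow> g y) G" for y
      using lim[of "\<lambda>v. apply_bcontfun v y"] by (simp add: J_def eval_in_dual g_def)
    have "continuous_on UNIV g"
      by (rule continuous_pointwise_limit[OF agree _ G lim_g]) simp
    moreover have "norm (g y) \<le> B" for y
      using norm_bounded[of "f _" y] bdd
      by (intro Lim_norm_ubound[OF G lim_g] always_eventually allI) (rule order_trans)
    ultimately have "g \<in> bcontfun" by (rule bcontfun_normI)
    then obtain v where v: "g = apply_bcontfun v" by (rule bcontfunE)
    have "J v \<phi> = \<xi> \<phi>" for \<phi>
    proof (cases "\<phi> \<in> dual_bcontfun")
      case True
      then have "((\<lambda>x. \<phi> (f x)) \<longlongrightarrow> \<phi> v) G"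
        by (intro tendsto_bounded_linear_if_pointwise[OF agree bdd lim_g[unfolded v]])
           (simp add: dual_bcontfun_def)
      then show ?thesis using True lim[of \<phi>] tendsto_unique[OF G] by (auto simp: J_def)
    next
      case False
      then show ?thesis using lim[of \<phi>] tendsto_unique[OF G tendsto_const, of 0] by (auto simp: J_def)
    qed
    then show ?thesis by blast
  qed
  then obtain I where I: "\<And>\<xi>. \<xi> \<in> K \<Longrightarrow> J (I \<xi>) = \<xi>"
    using bchoice[of K "\<lambda>\<xi> v. J v = \<xi>"] by blast
  have I_dual: "\<phi> (I \<xi>) = \<xi> \<phi>" if "\<xi> \<in> K" "\<phi> \<in> dual_bcontfun" for \<xi> \<phi>
    using fun_cong[OF I[OF that(1)], of \<phi>] that(2) by (simp add: J_def)
  have "continuous_map (top_of_set K) ?W I"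
    unfolding weak_topology_bcontfun_def
  proof (rule continuous_on_generated_topo)
    fix T assume "T \<in> {\<phi> -` U | \<phi> U. \<phi> \<in> (dual_bcontfun :: (('y \<Rightarrow>\<^sub>C complex) \<Rightarrow> complex) set) \<and> open U}"
    then obtain \<phi> U where T: "T = \<phi> -` U" "\<phi> \<in> dual_bcontfun" "open U" by blast
    have "I -` T \<inter> topspace (top_of_set K) = K \<inter> (\<lambda>\<xi>. \<xi> \<phi>) -` U"
      using I_dual[OF _ T(2)] by (auto simp: T(1))
    moreover have "open ((\<lambda>\<xi> :: (('y \<Rightarrow>\<^sub>C complex) \<Rightarrow> complex) \<Rightarrow> complex. \<xi> \<phi>) -` U)"
      by (rule open_vimage[OF T(3) continuous_on_product_coordinates])
    ultimately show "openin (top_of_set K) (I -` T \<inter> topspace (top_of_set K))"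
      by (simp add: openin_open_Int)
  next
    show "I ` topspace (top_of_set K) \<subseteq>
        \<Union> {\<phi> -` U | \<phi> U. \<phi> \<in> (dual_bcontfun :: (('y \<Rightarrow>\<^sub>C complex) \<Rightarrow> complex) set) \<and> open U}"
      using topspace_weak_topology_bcontfun[where 'a = 'y]
      unfolding weak_topology_bcontfun_def topology_generated_by_topspace by (simp only: subset_UNIV)
  qed
  moreover have "compactin (top_of_set K) K"
    using \<open>compact K\<close> by (simp add: compactin_subtopology)
  ultimately have cpt: "compactin ?W (I ` K)"
    by (rule image_compactin[rotated])
  have "f x \<in> I ` K" for x
  proof
    show K: "J (f x) \<in> K" unfolding K_def by (rule subsetD[OF closure_subset rangeI])
    have "apply_bcontfun (I (J (f x))) y = apply_bcontfun (f x) y" for y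
      using I_dual[OF K eval_in_dual[of y]] eval_in_dual[of y] by (simp add: J_def)
    then show "f x = I (J (f x))" by (metis bcontfun_eqI)
  qed
  then have "?W closure_of range f \<subseteq> I ` K"
    using compactin_imp_closedin[OF Hausdorff_weak_topology_bcontfun cpt]
    by (intro closure_of_minimal) auto
  then show ?thesis
    unfolding relatively_weakly_compact_def
    by (rule closed_compactin[OF cpt _ closedin_closure_of])
qed

text \<open>The hypothesis on the columns and the conclusion on the rows meet in the interchange of iterated
  limits of the common matrix.\<close>

lemma relatively_weakly_compact_transpose:
  fixes f :: "'x::topological_space \<Rightarrow> ('y::topological_space \<Rightarrow>\<^sub>C complex)"
    and k :: "'y \<Rightarrow> ('x \<Rightarrow>\<^sub>C complex)"
  assumes "\<And>x y. apply_bcontfun (f x) y = apply_bcontfun (k y) x" and "\<And>x. norm (f x) \<le> B"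
    and "relatively_weakly_compact (range k)"
  shows "relatively_weakly_compact (range f)"
proof (rule rows_compact_if_iterated_limits_agree)
  have "(\<lambda>x. apply_bcontfun (f x)) = (\<lambda>x y. apply_bcontfun (k y) x)"
    using assms(1) by (simp add: fun_eq_iff)
  then show "iterated_limits_agree (\<lambda>x. apply_bcontfun (f x))"
    using iterated_limits_agree_if_columns_compact[OF assms(3)] by simp
qed (rule assms(2))


section \<open>Weakly almost periodic functions\<close>

context semihypergroup
begin

lemma norm_conv_eval_le: "norm (conv_eval conv (apply_bcontfun f) x y) \<le> norm f"
proof -
  interpret prob_space "to_measure (conv (point_mass x) (point_mass y))"
    by (rule conv_point_masses_prob)
  have "integrable (to_measure (conv (point_mass x) (point_mass y))) (apply_bcontfun f)"
    by (rule integrable_const_bound[of _ "norm f"])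
       (auto simp: norm_bounded measurable_cong_sets[OF sets_to_measure refl]
         intro: borel_measurable_continuous_onI)
  then have "expectation (\<lambda>z. norm (apply_bcontfun f z)) \<le> expectation (\<lambda>_. norm f)"
    using norm_bounded by (intro integral_mono) auto
  with integral_norm_bound[of _ "apply_bcontfun f"]
  have "norm (expectation (apply_bcontfun f)) \<le> expectation (\<lambda>_. norm f)"
    by (rule order_trans)
  then show ?thesis by (simp add: conv_eval_def prob_space[unfolded space_to_measure])
qed

lemma WAP_r_eq_WAP_l: "WAP_r conv = WAP_l conv"
proof -
  have left: "norm (left_translate conv x f) \<le> norm f"
    and right: "norm (right_translate conv x f) \<le> norm f" for x f
    by (rule norm_bound, simp add: apply_left_translate apply_right_translate norm_conv_eval_le)+
  have "relatively_weakly_compact (left_orbit conv f)"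
    if "relatively_weakly_compact (right_orbit conv f)" for f
    unfolding left_orbit_def right_orbit_def
    by (rule relatively_weakly_compact_transpose[OF _ left that[unfolded right_orbit_def]])
       (simp add: apply_left_translate apply_right_translate)
  moreover have "relatively_weakly_compact (right_orbit conv f)"
    if "relatively_weakly_compact (left_orbit conv f)" for f
    unfolding left_orbit_def right_orbit_def
    by (rule relatively_weakly_compact_transpose[OF _ right that[unfolded left_orbit_def]])
       (simp add: apply_left_translate apply_right_translate)
  ultimately show ?thesis by (auto simp: WAP_r_def WAP_l_def)
qed

end

theorem theorem4p2:
  fixes conv :: "('a::t2_space) measure_op"
  assumes "semihypergroup conv"
  shows "WAP_r conv \<inter> UC conv = WAP_l conv \<inter> UC conv"
  using semihypergroup.WAP_r_eq_WAP_l[OF assms] by simp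

end
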